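(* Let $(b,0)$ be a connected graph over the countably infinite set $X$ (so $c\equiv0$). Then the following assertions are equivalent: (i) The graph $(b,0)$ is uniformly transient and every harmonic function of finite energy is constant. (ii) The graph $(b,0)$ is canonically compactifiable and every harmonic function of finite energy is constant. (iii) The graph $(b,0)$ is transient and the Royden compactification of $X$ is the one-point compactification of $X$.
   Context: $X$ is a countably infinite (discrete) set, $C(X)$ the real-valued functions on $X$, $C_c(X)$ those with finite support, $\ell^\infty(X)$ the bounded ones, $\|f\|_\infty=\sup_X|f|$, and $C_0(X)$ is the closure of $C_c(X)$ with respect to $\|\cdot\|_\infty$. A graph $(b,c)$ over $X$ consists of a symmetric $b:X\times X\to[0,\infty)$ with zero diagonal and $\sum_{y}b(x,y)<\infty$ for all $x$, and an arbitrary $c:X\to[0,\infty)$; here $c\equiv 0$. It is connected if for any two distinct $x,y\in X$ there are $x=x_0,\dots,x_n=y$ with $b(x_{i-1},x_i)>0$ for $i=1,\dots,n$. For $f\in C(X)$ put $\widetilde Q(f)=\frac12\sum_{x,y}b(x,y)|f(x)-f(y)|^2\in[0,\infty]$ (case $c\equiv0$) and $\widetilde D=\{f\in C(X):\widetilde Q(f)<\infty\}$; functions in $\widetilde D$ are said to have finite energy. For $o\in X$ put $\|f\|_o=(\widetilde Q(f)+|f(o)|^2)^{1/2}$; $\widetilde D_0$ is the closure of $C_c(X)$ in $\widetilde D$ with respect to $\|\cdot\|_o$ (independent of $o$ for connected graphs). A connected graph is recurrent if $1\in\widetilde D_0$ and $\widetilde Q(1)=0$ (the latter is automatic for $c\equiv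 0$), and transient if it is not recurrent. It is uniformly transient if $\widetilde D_0\subseteq C_0(X)$, and canonically compactifiable if $\widetilde D\subseteq\ell^\infty(X)$. A function $f$ with $\sum_y b(x,y)|f(y)|<\infty$ for all $x$ is harmonic if $\sum_y b(x,y)(f(x)-f(y))=0$ for all $x\in X$. The Royden compactification $R$ is the unique (up to homeomorphism) compact Hausdorff space such that $X$ is a dense open subset of $R$, each function in $\widetilde D\cap\ell^\infty(X)$ extends uniquely to a continuous function on $R$, and (the extensions of) $\widetilde D\cap\ell^\infty(X)$ separate the points of $R$. *)

theory Defs
  imports "HOL-Analysis.Analysis"
begin

text \<open>
  Weighted graphs with vanishing killing term. The vertex set is the whole type \<open>'v\<close>;
  that it is countably infinite is an explicit hypothesis wherever it is needed.
\<close>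

definition weighted_graph :: "('v \<Rightarrow> 'v \<Rightarrow> real) \<Rightarrow> bool" where
  "weighted_graph b \<longleftrightarrow>
     (\<forall>x y. b x y \<ge> 0) \<and> (\<forall>x y. b x y = b y x) \<and> (\<forall>x. b x x = 0) \<and>
     (\<forall>x. (\<lambda>y. b x y) summable_on UNIV)"

definition connected_graph :: "('v \<Rightarrow> 'v \<Rightarrow> real) \<Rightarrow> bool" where
  "connected_graph b \<longleftrightarrow>
     (\<forall>x y. x \<noteq> y \<longrightarrow>
        (\<exists>(n::nat) p. p 0 = x \<and> p n = y \<and> (\<forall>i\<in>{1..n}. b (p (i - 1)) (p i) > 0)))"

definition finite_support :: "('v \<Rightarrow> real) set" where
  "finite_support = {f. finite {x. f x \<noteq> 0}}"

definition bounded_functions :: "('v \<Rightarrow> real) set" where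
  "bounded_functions = {f. bounded (range f)}"

definition sup_norm :: "('v \<Rightarrow> real) \<Rightarrow> real" where
  "sup_norm f = (SUP x. \<bar>f x\<bar>)"

text \<open>The real supremum is meaningful only for bounded functions, so the closure of the
  finitely supported functions is taken inside the bounded ones.\<close>

definition vanishing_at_infinity :: "('v \<Rightarrow> real) set" where
  "vanishing_at_infinity =
     {f \<in> bounded_functions. \<forall>\<epsilon>>0. \<exists>g\<in>finite_support. sup_norm (\<lambda>x. f x - g x) < \<epsilon>}"

definition energy :: "('v \<Rightarrow> 'v \<Rightarrow> real) \<Rightarrow> ('v \<Rightarrow> real) \<Rightarrow> ennreal" where
  "energy b f = (1 / 2) * (\<Sum>\<^sub>\<infinity>(x, y)\<in>UNIV. ennreal (b x y * \<bar>f x - f y\<bar>\<^sup>2))"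

definition finite_energy :: "('v \<Rightarrow> 'v \<Rightarrow> real) \<Rightarrow> ('v \<Rightarrow> real) set" where
  "finite_energy b = {f. energy b f < \<infinity>}"

definition energy_norm :: "('v \<Rightarrow> 'v \<Rightarrow> real) \<Rightarrow> 'v \<Rightarrow> ('v \<Rightarrow> real) \<Rightarrow> real" where
  "energy_norm b r f = sqrt (enn2real (energy b f) + \<bar>f r\<bar>\<^sup>2)"

text \<open>For connected graphs the following notions do not depend on the base vertex \<open>r\<close>.\<close>

definition finite_energy0 :: "('v \<Rightarrow> 'v \<Rightarrow> real) \<Rightarrow> 'v \<Rightarrow> ('v \<Rightarrow> real) set" where
  "finite_energy0 b r =
     {f \<in> finite_energy b. \<forall>\<epsilon>>0. \<exists>g\<in>finite_support. energy_norm b r (\<lambda>x. f x - g x) < \<epsilon>}"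

definition recurrent :: "('v \<Rightarrow> 'v \<Rightarrow> real) \<Rightarrow> 'v \<Rightarrow> bool" where
  "recurrent b r \<longleftrightarrow> (\<lambda>_. 1) \<in> finite_energy0 b r \<and> energy b (\<lambda>_. 1) = 0"

definition transient :: "('v \<Rightarrow> 'v \<Rightarrow> real) \<Rightarrow> 'v \<Rightarrow> bool" where
  "transient b r \<longleftrightarrow> \<not> recurrent b r"

definition uniformly_transient :: "('v \<Rightarrow> 'v \<Rightarrow> real) \<Rightarrow> 'v \<Rightarrow> bool" where
  "uniformly_transient b r \<longleftrightarrow> finite_energy0 b r \<subseteq> vanishing_at_infinity"

definition canonically_compactifiable :: "('v \<Rightarrow> 'v \<Rightarrow> real) \<Rightarrow> bool" where
  "canonically_compactifiable b \<longleftrightarrow> finite_energy b \<subseteq> bounded_functions"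

definition harmonic :: "('v \<Rightarrow> 'v \<Rightarrow> real) \<Rightarrow> ('v \<Rightarrow> real) \<Rightarrow> bool" where
  "harmonic b f \<longleftrightarrow>
     (\<forall>x. (\<lambda>y. b x y * \<bar>f y\<bar>) summable_on UNIV) \<and>
     (\<forall>x. (\<Sum>\<^sub>\<infinity>y\<in>UNIV. b x y * (f x - f y)) = 0)"

text \<open>
  A compactification of the discrete space \<open>'v\<close> is a space \<open>R\<close> together with the inclusion
  \<open>i\<close> of \<open>'v\<close> into it. Extensions are taken in \<open>extensional (topspace R)\<close> so that their
  uniqueness refers only to the values on the points of \<open>R\<close>.
\<close>

definition continuous_extension ::
    "'r topology \<Rightarrow> ('v \<Rightarrow> 'r) \<Rightarrow> ('v \<Rightarrow> real) \<Rightarrow> ('r \<Rightarrow> real) \<Rightarrow> bool" where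
  "continuous_extension R i f F \<longleftrightarrow>
     F \<in> extensional (topspace R) \<and> continuous_map R euclideanreal F \<and> (\<forall>x. F (i x) = f x)"

definition is_Royden_compactification ::
    "('v \<Rightarrow> 'v \<Rightarrow> real) \<Rightarrow> 'r topology \<Rightarrow> ('v \<Rightarrow> 'r) \<Rightarrow> bool" where
  "is_Royden_compactification b R i \<longleftrightarrow>
     compact_space R \<and> Hausdorff_space R \<and>
     embedding_map (discrete_topology UNIV) R i \<and>
     openin R (range i) \<and> R closure_of (range i) = topspace R \<and>
     (\<forall>f \<in> finite_energy b \<inter> bounded_functions. \<exists>!F. continuous_extension R i f F) \<and>
     (\<forall>p \<in> topspace R. \<forall>q \<in> topspace R. p \<noteq> q \<longrightarrow>
        (\<exists>f \<in> finite_energy b \<inter> bounded_functions. \<exists>F. continuous_extension R i f F \<and> F p \<noteq> F q))"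

text \<open>
  The Royden compactification, unique up to a homeomorphism that fixes the vertices, is chosen
  among the spaces whose points are functionals on functions. That such a space exists, and
  that the choice does not matter (even among spaces over other types), is
  \<open>is_Royden_compactification_Royden\<close> and \<open>Royden_compactification_unique\<close> below.
\<close>

definition Royden_compactification ::
    "('v \<Rightarrow> 'v \<Rightarrow> real) \<Rightarrow> (('v \<Rightarrow> real) \<Rightarrow> real) topology \<times> ('v \<Rightarrow> ('v \<Rightarrow> real) \<Rightarrow> real)" where
  "Royden_compactification b = (SOME (R, i). is_Royden_compactification b R i)"

definition is_one_point_compactification :: "'r topology \<Rightarrow> ('v \<Rightarrow> 'r) \<Rightarrow> bool" where
  "is_one_point_compactification R i \<longleftrightarrow>
     (\<exists>h. homeomorphic_map R (Alexandroff_compactification (discrete_topology (UNIV :: 'v set))) h \<and>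
          (\<forall>x. h (i x) = Some x))"

lemma finite_energy_indicator:
  assumes "weighted_graph b"
  shows "(\<lambda>x. if x = u then 1 else 0) \<in> finite_energy b"
proof -
  define h where "h = (\<lambda>(x, y). b x y * \<bar>(if x = u then 1 else 0) - (if y = u then 1 else (0::real))\<bar>\<^sup>2)"
  have nn: "b x y \<ge> 0" and sym: "b x y = b y x" and diag: "b x x = 0"
    and sm: "(\<lambda>y. b x y) summable_on UNIV" for x y
    using assms by (auto simp: weighted_graph_def)
  have h0: "h p \<ge> 0" for p using nn by (cases p) (auto simp: h_def)
  have eq: "h (u, y) = b u y" "h (y, u) = b u y" for y
    using diag sym by (auto simp: h_def)
  have 1: "h summable_on range (\<lambda>y. (u, y))"
    by (subst summable_on_reindex) (auto simp: inj_on_def o_def eq sm)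
  have 2: "h summable_on range (\<lambda>y. (y, u))"
    by (subst summable_on_reindex) (auto simp: inj_on_def o_def eq sm)
  have 3: "h summable_on range (\<lambda>y. (y, u)) - range (\<lambda>y. (u, y))"
    by (rule summable_on_subset_banach[OF 2]) auto
  have 4: "h summable_on (range (\<lambda>y. (u, y)) \<union> (range (\<lambda>y. (y, u)) - range (\<lambda>y. (u, y))))"
    by (rule summable_on_Un_disjoint[OF 1 3]) auto
  have S: "h summable_on UNIV"
  proof (rule summable_on_cong_neutral[THEN iffD1, OF _ _ _ 4])
    show "h p = 0" if "p \<in> UNIV - (range (\<lambda>y. (u, y)) \<union> (range (\<lambda>y. (y, u)) - range (\<lambda>y. (u, y))))" for p
      using that by (cases p) (auto simp: h_def image_iff)
  qed auto
  have "(\<Sum>\<^sub>\<infinity>p\<in>UNIV. ennreal (h p)) \<le> ennreal (infsum h UNIV)"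
  proof (rule infsum_le_finite_sums)
    show "(\<lambda>p. ennreal (h p)) summable_on UNIV" by (rule nonneg_summable_on_complete) simp
    show "(\<Sum>p\<in>F. ennreal (h p)) \<le> ennreal (infsum h UNIV)" if "finite F" "F \<subseteq> UNIV" for F
      using that h0 by (subst sum_ennreal) (auto intro!: ennreal_leI finite_sum_le_infsum S)
  qed
  then have "(\<Sum>\<^sub>\<infinity>p\<in>UNIV. ennreal (h p)) < \<infinity>"
    by (simp add: le_less_trans)
  moreover have "(1 / 2 :: ennreal) < \<infinity>"
    by (simp add: ennreal_divide_eq_top_iff less_top[symmetric])
  ultimately have "(1 / 2) * (\<Sum>\<^sub>\<infinity>p\<in>UNIV. ennreal (h p)) < \<infinity>"
    by (simp only: infinity_ennreal_def ennreal_mult_less_top) blast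
  then show ?thesis
    by (simp add: finite_energy_def energy_def h_def case_prod_unfold)
qed

text \<open>The closure of the vertices in the product of the lines indexed by the bounded functions
  of finite energy.\<close>

lemma is_Royden_compactification_exists:
  fixes b :: "'v \<Rightarrow> 'v \<Rightarrow> real"
  assumes "weighted_graph b"
  defines "A \<equiv> finite_energy b \<inter> bounded_functions"
  defines "i \<equiv> (\<lambda>x. \<lambda>f\<in>A. f x)"
  defines "P \<equiv> product_topology (\<lambda>_. euclideanreal) A"
  defines "R \<equiv> subtopology P (P closure_of (range i))"
  shows "is_Royden_compactification b R i"
proof -
  have topP: "topspace P = (\<Pi>\<^sub>E f\<in>A. UNIV)" by (simp add: P_def)
  have iP: "range i \<subseteq> topspace P" by (auto simp: topP i_def)
  have iR: "range i \<subseteq> topspace R"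
    using closure_of_subset[OF iP] iP by (auto simp: R_def)
  have topR: "topspace R = P closure_of (range i)"
    using closure_of_subset_topspace by (fastforce simp: R_def)
  have HP: "Hausdorff_space P" by (simp add: P_def Hausdorff_space_product_topology)
  then have HR: "Hausdorff_space R" by (simp add: R_def Hausdorff_space_subtopology)
  have "\<exists>B. \<forall>x. \<bar>f x\<bar> \<le> B" if "f \<in> A" for f
    using that by (auto simp: A_def bounded_functions_def bounded_iff)
  then obtain B where B: "\<bar>f x\<bar> \<le> B f" if "f \<in> A" for f x by metis
  have comp: "compactin P (\<Pi>\<^sub>E f\<in>A. {- B f..B f})"
    by (simp add: P_def compactin_PiE)
  have "range i \<subseteq> (\<Pi>\<^sub>E f\<in>A. {- B f..B f})"
    using B by (auto simp: i_def abs_le_iff minus_le_iff)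
  then have "P closure_of (range i) \<subseteq> (\<Pi>\<^sub>E f\<in>A. {- B f..B f})"
    by (rule closure_of_minimal) (rule compactin_imp_closedin[OF HP comp])
  then have "compactin P (P closure_of (range i))"
    by (rule closed_compactin[OF comp]) simp
  then have CR: "compact_space R"
    by (simp add: R_def compact_space_subtopology)
  have dense: "R closure_of (range i) = topspace R"
    unfolding R_def
    by (subst closure_of_subtopology)
       (use closure_of_subset[OF iP] topR in \<open>auto simp: R_def Int_absorb1\<close>)
  define e where "e u = (\<lambda>x::'v. if x = u then 1 else (0::real))" for u
  have eA: "e u \<in> A" for u
    using finite_energy_indicator[OF assms(1), of u]
    by (auto simp: A_def e_def bounded_functions_def bounded_iff intro!: exI[of _ 1])
  have proj: "continuous_map R euclideanreal (\<lambda>p. p f)" if "f \<in> A" for f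
    unfolding R_def P_def
    by (rule continuous_map_from_subtopology) (rule continuous_map_product_projection[OF that])
  have pt: "openin R {i u}" for u
  proof -
    define U where "U = {p \<in> topspace R. p (e u) \<in> {1/2<..}}"
    have oU: "openin R U"
      unfolding U_def by (rule openin_continuous_map_preimage[OF proj[OF eA]]) simp
    have iu: "i v \<in> U \<longleftrightarrow> v = u" for v
      using iR eA[of u] by (auto simp: U_def i_def e_def)
    have cl: "closedin R {i u}"
      using iR HR by (auto intro!: closedin_Hausdorff_singleton)
    have "openin R (U - {i u})" by (rule openin_diff[OF oU cl])
    moreover have "(U - {i u}) \<inter> range i = {}" using iu by auto
    ultimately have "(U - {i u}) \<inter> R closure_of (range i) = {}"
      by (simp add: openin_Int_closure_of_eq_empty)
    then have "U - {i u} = {}" unfolding dense by (auto simp: U_def)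
    then have "U = {i u}" using iu by auto
    then show ?thesis using oU by simp
  qed
  have opn: "openin R (i ` S)" for S
  proof -
    have "i ` S = \<Union> ((\<lambda>u. {i u}) ` S)" by auto
    then show ?thesis using pt by (metis (no_types, lifting) imageE openin_Union)
  qed
  have inj: "inj i"
  proof (rule injI)
    fix x y assume "i x = i y"
    then have "i x (e x) = i y (e x)" by simp
    then show "x = y" using eA[of x] by (auto simp: i_def e_def split: if_splits)
  qed
  have emb: "embedding_map (discrete_topology UNIV) R i"
  proof (rule injective_open_imp_embedding_map)
    show "continuous_map (discrete_topology UNIV) R i" using iR by auto
    show "open_map (discrete_topology UNIV) R i" using opn by (auto simp: open_map_def)
    show "inj_on i (topspace (discrete_topology UNIV))" using inj by simp
  qed
  have ext: "continuous_extension R i f (\<lambda>p\<in>topspace R. p f)" if "f \<in> A" for f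
  proof -
    have "continuous_map R euclideanreal (\<lambda>p\<in>topspace R. p f)"
      by (rule continuous_map_eq[OF proj[OF that]]) simp
    then show ?thesis
      using iR that by (auto simp: continuous_extension_def i_def)
  qed
  have uniq: "F = G" if "continuous_extension R i f F" "continuous_extension R i f G" for f F G
  proof (rule extensionalityI)
    show "F \<in> extensional (topspace R)" "G \<in> extensional (topspace R)"
      using that by (auto simp: continuous_extension_def)
    fix p assume "p \<in> topspace R"
    then have "p \<in> R closure_of (range i)" by (simp add: dense)
    then show "F p = G p"
      by (rule forall_in_closure_of_eq[where Y = euclideanreal])
         (use that in \<open>auto simp: continuous_extension_def\<close>)
  qed
  have sep: "\<exists>f\<in>A. \<exists>F. continuous_extension R i f F \<and> F p \<noteq> F q"
    if pq: "p \<in> topspace R" "q \<in> topspace R" "p \<noteq> q" for p q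
  proof -
    have "p \<in> (\<Pi>\<^sub>E f\<in>A. UNIV)" "q \<in> (\<Pi>\<^sub>E f\<in>A. UNIV)"
      using pq by (auto simp: R_def topP)
    then obtain f where "f \<in> A" "p f \<noteq> q f"
      using pq(3) by (metis PiE_ext)
    then show ?thesis using ext pq by (metis restrict_apply')
  qed
  show ?thesis
    unfolding is_Royden_compactification_def A_def[symmetric]
  proof (intro conjI ballI impI)
    show "\<exists>!F. continuous_extension R i f F" if "f \<in> A" for f
      using ext[OF that] uniq by metis
  qed (fact CR HR emb opn[of UNIV] dense | rule sep, assumption+)+
qed

lemma is_Royden_compactification_Royden:
  assumes "weighted_graph b" "Royden_compactification b = (R, i)"
  shows "is_Royden_compactification b R i"
  using someI_ex[of "\<lambda>(R, i). is_Royden_compactification b R i"]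
    is_Royden_compactification_exists[OF assms(1)] assms(2)
  unfolding Royden_compactification_def by fastforce

lemma Royden_compactification_unique:
  fixes R :: "'r topology" and S :: "'s topology" and i :: "'v \<Rightarrow> 'r" and j :: "'v \<Rightarrow> 's"
  assumes R: "is_Royden_compactification b R i" and S: "is_Royden_compactification b S j"
  shows "\<exists>h. homeomorphic_map R S h \<and> (\<forall>x. h (i x) = j x)"
proof -
  define A where "A = finite_energy b \<inter> bounded_functions"
  define P where "P = product_topology (\<lambda>_. euclideanreal) A"
  define k where "k = (\<lambda>x::'v. \<lambda>f\<in>A. f x)"
  have HP: "Hausdorff_space P" by (simp add: P_def Hausdorff_space_product_topology)
  have model: "\<exists>h. homeomorphic_map T (subtopology P (P closure_of (range k))) h \<and> (\<forall>x. h (l x) = k x)"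
    if T: "is_Royden_compactification b T l" for T :: "'t topology" and l
  proof -
    have ex: "\<exists>F. continuous_extension T l f F" if "f \<in> A" for f
      using T that unfolding is_Royden_compactification_def A_def by blast
    then obtain E where E: "continuous_extension T l f (E f)" if "f \<in> A" for f by metis
    have un: "F = G" if "f \<in> A" "continuous_extension T l f F" "continuous_extension T l f G" for f F G
      using T that unfolding is_Royden_compactification_def A_def by blast
    define h where "h = (\<lambda>p. \<lambda>f\<in>A. E f p)"
    have cont: "continuous_map T P h"
      using E by (auto simp: P_def h_def continuous_map_componentwise continuous_extension_def)
    have hl: "h (l x) = k x" for x
      using E by (auto simp: h_def k_def continuous_extension_def)
    have dense: "T closure_of (range l) = topspace T" and CT: "compact_space T"
      and lT: "range l \<subseteq> topspace T"
      using T openin_subset by (auto simp: is_Royden_compactification_def)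
    have inj: "inj_on h (topspace T)"
    proof (rule inj_onI, rule ccontr)
      fix p q assume pq: "p \<in> topspace T" "q \<in> topspace T" "h p = h q" "p \<noteq> q"
      then obtain f F where f: "f \<in> A" "continuous_extension T l f F" "F p \<noteq> F q"
        using T unfolding is_Royden_compactification_def A_def by meson
      then have "E f p \<noteq> E f q" using un E by metis
      then show False using pq(3) f(1) by (metis h_def restrict_apply')
    qed
    have cl: "closed_map T P h" by (rule continuous_imp_closed_map[OF cont CT HP])
    have im: "h ` topspace T = P closure_of (range k)"
    proof -
      have rk: "range k = h ` range l" using hl by (auto simp: image_image)
      have "P closure_of (h ` range l) \<subseteq> h ` (T closure_of (range l))"
        using cl lT by (simp add: closed_map_closure_of_image)
      moreover have "h ` (T closure_of (range l)) \<subseteq> P closure_of (h ` range l)"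
        by (rule continuous_map_image_closure_subset[OF cont])
      ultimately show ?thesis by (simp add: rk dense)
    qed
    have "embedding_map T P h"
      by (rule injective_closed_imp_embedding_map[OF cont cl inj])
    then show ?thesis using hl by (auto simp: embedding_map_def im)
  qed
  obtain g where g: "homeomorphic_map R (subtopology P (P closure_of (range k))) g" "\<And>x. g (i x) = k x"
    using model[OF R] by blast
  obtain h where h: "homeomorphic_map S (subtopology P (P closure_of (range k))) h" "\<And>x. h (j x) = k x"
    using model[OF S] by blast
  obtain h' where h': "homeomorphic_maps S (subtopology P (P closure_of (range k))) h h'"
    using h(1) by (auto simp: homeomorphic_map_maps)
  have jS: "j x \<in> topspace S" for x
    using S openin_subset by (fastforce simp: is_Royden_compactification_def)
  have "homeomorphic_map R S (h' \<circ> g)"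
    using h' g(1) homeomorphic_map_compose homeomorphic_maps_map by blast
  moreover have "(h' \<circ> g) (i x) = j x" for x
    using h' jS[of x] by (simp add: g(2) h(2)[symmetric] homeomorphic_maps_def)
  ultimately show ?thesis by blast
qed

end

theory Submission
  imports Defs
begin

text \<open>
  By Fatou's lemma the energy is lower semicontinuous under pointwise convergence, and on a
  connected graph the energy controls differences of values. If all functions of finite energy are
  bounded, a gliding hump shows that the norm of \<open>finite_energy b\<close> dominates the supremum norm, so
  that limits of finitely supported functions vanish at infinity. Conversely, on a transient graph
  a function of finite energy is the sum of such a limit and a harmonic function; if the latter is
  constant and the former vanishes at infinity, the function is bounded and extends continuously to
  the one-point compactification, which is therefore the Royden compactification.

  If the Royden compactification is the one-point compactification, then bounded functions of finite
  energy have a limit at infinity, and a harmonic one equals its limit by the maximum principle. An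
  unbounded \<open>f \<ge> 0\<close> of finite energy would tend to infinity, and the finitely supported functions
  \<open>1 - min f n / n\<close> would converge to \<open>1\<close>, contradicting transience.
\<close>

text \<open>The energy is \<open>ennreal\<close>-valued while the estimates are carried out over the
  reals. The embedding is continuous and additive on nonnegative reals, so it passes through partial
  sums to their limit.\<close>

lemma has_sum_ennreal:
  fixes h :: "'a \<Rightarrow> real"
  assumes "(h has_sum s) A" "\<And>p. h p \<ge> 0"
  shows "((\<lambda>p. ennreal (h p)) has_sum ennreal s) A"
proof -
  have "((\<lambda>F. ennreal (sum h F)) \<longlongrightarrow> ennreal s) (finite_subsets_at_top A)"
    using assms(1) by (intro tendsto_ennrealI) (simp add: has_sum_def)
  moreover have "(\<lambda>F. ennreal (sum h F)) = sum (\<lambda>p. ennreal (h p))"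
    using assms(2) by (intro ext) (simp add: sum_ennreal)
  ultimately show ?thesis
    by (simp add: has_sum_def)
qed

lemma finite_support_add:
  assumes "f \<in> finite_support" "g \<in> finite_support"
  shows "(\<lambda>x. f x + g x) \<in> finite_support"
  using assms unfolding finite_support_def
  by (auto intro: finite_subset[of _ "{x. f x \<noteq> 0} \<union> {x. g x \<noteq> 0}"])

lemma finite_support_scale: "f \<in> finite_support \<Longrightarrow> (\<lambda>x. c * f x) \<in> finite_support"
  unfolding finite_support_def by (auto elim!: rev_finite_subset)

section \<open>The energy seminorm on a weighted graph\<close>

locale energy_graph =
  fixes b :: "'v \<Rightarrow> 'v \<Rightarrow> real"
  assumes weighted: "weighted_graph b"
begin

lemma b_nonneg: "b x y \<ge> 0" and b_sym: "b x y = b y x" and b_diag: "b x x = 0"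
  and b_summable: "(\<lambda>y. b x y) summable_on UNIV"
  using weighted by (auto simp: weighted_graph_def)

text \<open>The root of the weight turns the energy into the squared l2 norm of a function linear in
  \<open>f\<close>, so that the Minkowski inequality for \<open>L2_set\<close> applies.\<close>

definition edge_diff :: "('v \<Rightarrow> real) \<Rightarrow> 'v \<times> 'v \<Rightarrow> real" where
  "edge_diff f p = sqrt (b (fst p) (snd p)) * (f (fst p) - f (snd p))"

text \<open>For \<open>f\<close> of finite energy this is the square root of twice the energy.
  Otherwise \<open>infsum\<close> defaults to 0, which is why most estimates assume membership in
  \<open>finite_energy b\<close>.\<close>

definition seminorm :: "('v \<Rightarrow> real) \<Rightarrow> real" where
  "seminorm f = sqrt (\<Sum>\<^sub>\<infinity>p. (edge_diff f p)\<^sup>2)"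

lemma edge_diff_square: "(edge_diff f (x, y))\<^sup>2 = b x y * \<bar>f x - f y\<bar>\<^sup>2"
  using b_nonneg by (simp add: edge_diff_def power_mult_distrib)

lemma energy_eq: "energy b f = (1 / 2) * (\<Sum>\<^sub>\<infinity>p. ennreal ((edge_diff f p)\<^sup>2))"
  unfolding energy_def by (rule arg_cong[where f = "\<lambda>z. (1/2) * z"], rule infsum_cong)
    (auto simp: edge_diff_square)

text \<open>A nonnegative real family is summable exactly if its finite partial sums are bounded,
  and the \<open>ennreal\<close> sum is their supremum.\<close>

lemma finite_energy_iff:
  "f \<in> finite_energy b \<longleftrightarrow> (\<lambda>p. (edge_diff f p)\<^sup>2) summable_on UNIV" (is "_ \<longleftrightarrow> ?h summable_on _")
proof
  assume "f \<in> finite_energy b"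
  then have fin: "(\<Sum>\<^sub>\<infinity>p. ennreal (?h p)) < \<infinity>"
    by (auto simp: finite_energy_def energy_eq ennreal_mult_less_top ennreal_divide_eq_top_iff)
  define S where "S = enn2real (\<Sum>\<^sub>\<infinity>p. ennreal (?h p))"
  have S: "(\<Sum>\<^sub>\<infinity>p. ennreal (?h p)) = ennreal S"
    using fin by (simp add: S_def)
  have "sum ?h F \<le> S" if "finite F" for F
  proof -
    have "(\<Sum>p\<in>F. ennreal (?h p)) \<le> (\<Sum>\<^sub>\<infinity>p. ennreal (?h p))"
      using that by (subst nonneg_infsum_complete) (auto intro: SUP_upper)
    then show ?thesis
      unfolding S by (subst (asm) sum_ennreal) (auto simp: S_def)
  qed
  then show "?h summable_on UNIV"
    by (intro nonneg_bdd_above_summable_on) (auto intro!: bdd_aboveI)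
next
  assume "?h summable_on UNIV"
  then have "(\<Sum>\<^sub>\<infinity>p. ennreal (?h p)) = ennreal (\<Sum>\<^sub>\<infinity>p. ?h p)"
    by (intro infsumI has_sum_ennreal) auto
  then show "f \<in> finite_energy b"
    by (simp add: finite_energy_def energy_eq ennreal_mult_less_top less_top[symmetric]
        ennreal_mult_eq_top_iff ennreal_divide_eq_top_iff)
qed

lemma seminorm_nonneg [simp]: "seminorm f \<ge> 0"
  by (simp add: seminorm_def infsum_nonneg)

lemma seminorm_square: "(seminorm f)\<^sup>2 = (\<Sum>\<^sub>\<infinity>p. (edge_diff f p)\<^sup>2)"
  by (simp add: seminorm_def infsum_nonneg)

lemma enn2real_energy:
  assumes "f \<in> finite_energy b"
  shows "enn2real (energy b f) = (seminorm f)\<^sup>2 / 2"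
proof -
  have "(\<Sum>\<^sub>\<infinity>p. ennreal ((edge_diff f p)\<^sup>2)) = ennreal ((seminorm f)\<^sup>2)"
    using assms unfolding seminorm_square finite_energy_iff
    by (intro infsumI has_sum_ennreal) auto
  moreover have "(1 / 2 :: ennreal) = ennreal (1 / 2)"
    by (metis divide_ennreal ennreal_1 ennreal_numeral zero_le_one zero_less_numeral)
  ultimately show ?thesis
    by (simp add: energy_eq enn2real_mult del: ennreal_half)
qed

lemma L2_set_le_seminorm:
  assumes "f \<in> finite_energy b" "finite F"
  shows "L2_set (edge_diff f) F \<le> seminorm f"
  unfolding L2_set_def seminorm_def using assms
  by (intro real_sqrt_le_mono finite_sum_le_infsum) (auto simp: finite_energy_iff)

text \<open>Together with \<open>L2_set_le_seminorm\<close> this reduces every bound on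
  \<open>seminorm\<close> to finite sets of pairs; finiteness of the energy comes along with the
  bound.\<close>

lemma seminorm_leI:
  assumes "\<And>F. finite F \<Longrightarrow> L2_set (edge_diff f) F \<le> M"
  shows "f \<in> finite_energy b" and "seminorm f \<le> M"
proof -
  have M: "M \<ge> 0" using assms[of "{}"] by simp
  have fs: "(\<Sum>p\<in>F. (edge_diff f p)\<^sup>2) \<le> M\<^sup>2" if "finite F" for F
    using assms[OF that] by (simp add: L2_set_def sqrt_le_D)
  show *: "f \<in> finite_energy b"
    unfolding finite_energy_iff using fs
    by (intro nonneg_bdd_above_summable_on) (auto intro!: bdd_aboveI)
  have "(\<Sum>\<^sub>\<infinity>p. (edge_diff f p)\<^sup>2) \<le> M\<^sup>2"
    using * fs by (intro infsum_le_finite_sums) (auto simp: finite_energy_iff)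
  then show "seminorm f \<le> M"
    using M by (simp add: seminorm_def real_le_lsqrt infsum_nonneg)
qed

lemma seminorm_triangle:
  assumes "f \<in> finite_energy b" "g \<in> finite_energy b"
  shows "(\<lambda>x. f x + g x) \<in> finite_energy b" and "seminorm (\<lambda>x. f x + g x) \<le> seminorm f + seminorm g"
proof -
  have "L2_set (edge_diff (\<lambda>x. f x + g x)) F \<le> seminorm f + seminorm g" if "finite F" for F
  proof -
    have "L2_set (edge_diff (\<lambda>x. f x + g x)) F = L2_set (\<lambda>p. edge_diff f p + edge_diff g p) F"
      by (intro L2_set_cong) (auto simp: edge_diff_def algebra_simps)
    also have "\<dots> \<le> L2_set (edge_diff f) F + L2_set (edge_diff g) F"
      by (rule L2_set_triangle_ineq)
    finally show ?thesis
      using L2_set_le_seminorm[OF assms(1) that] L2_set_le_seminorm[OF assms(2) that] by linarith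
  qed
  from seminorm_leI[OF this] show "(\<lambda>x. f x + g x) \<in> finite_energy b" "seminorm (\<lambda>x. f x + g x) \<le> seminorm f + seminorm g"
    by auto
qed

text \<open>The comparison holds edge by edge. It covers scaling, absolute values and truncations at
  once.\<close>

lemma seminorm_contraction:
  assumes "f \<in> finite_energy b" "\<And>x y. \<bar>g x - g y\<bar> \<le> c * \<bar>f x - f y\<bar>" "c \<ge> 0"
  shows "g \<in> finite_energy b" and "seminorm g \<le> c * seminorm f"
proof -
  have "L2_set (edge_diff g) F \<le> c * seminorm f" if "finite F" for F
  proof -
    have "L2_set (edge_diff g) F = L2_set (\<lambda>p. \<bar>edge_diff g p\<bar>) F"
      by (simp add: L2_set_def)
    also have "\<dots> \<le> L2_set (\<lambda>p. c * \<bar>edge_diff f p\<bar>) F"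
      using assms(2) b_nonneg
      by (intro L2_set_mono)
        (auto simp: edge_diff_def abs_mult mult.left_commute[of c] intro!: mult_left_mono)
    also have "\<dots> = c * L2_set (edge_diff f) F"
      using assms(3) by (subst L2_set_right_distrib[symmetric]) (auto simp: L2_set_def)
    finally show ?thesis
      using L2_set_le_seminorm[OF assms(1) that] assms(3) by (meson mult_left_mono order_trans)
  qed
  from seminorm_leI[OF this] show "g \<in> finite_energy b" "seminorm g \<le> c * seminorm f"
    by auto
qed

lemma seminorm_scale:
  assumes "f \<in> finite_energy b"
  shows "(\<lambda>x. c * f x) \<in> finite_energy b" and "seminorm (\<lambda>x. c * f x) \<le> \<bar>c\<bar> * seminorm f"
  using seminorm_contraction[OF assms, of "\<lambda>x. c * f x" "\<bar>c\<bar>"]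
  by (auto simp: abs_mult[symmetric] algebra_simps)

lemma seminorm_diff:
  assumes "f \<in> finite_energy b" "g \<in> finite_energy b"
  shows "(\<lambda>x. f x - g x) \<in> finite_energy b" and "seminorm (\<lambda>x. f x - g x) \<le> seminorm f + seminorm g"
  using seminorm_triangle[OF assms(1) seminorm_scale(1)[OF assms(2), of "-1"]]
    seminorm_scale(2)[OF assms(2), of "-1"] by auto

lemma seminorm_const_minus: "seminorm (\<lambda>x. c - f x) = seminorm f"
  by (simp add: seminorm_def edge_diff_def power_mult_distrib power2_commute)

lemma finite_energy_const: "(\<lambda>_. c) \<in> finite_energy b"
  by (rule seminorm_leI[where M = 0]) (auto simp: edge_diff_def L2_set_def)

text \<open>Fatou's lemma: on a finite set of pairs only finitely many values of \<open>g n\<close>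
  occur, so the bound passes to the limit there, and the finite set is arbitrary.\<close>

lemma seminorm_lower_semicontinuous:
  assumes "\<And>n. g n \<in> finite_energy b" "\<And>x. (\<lambda>n. g n x) \<longlonglongrightarrow> f x"
    and "eventually (\<lambda>n. seminorm (g n) \<le> M) sequentially"
  shows "f \<in> finite_energy b" and "seminorm f \<le> M"
proof -
  have "L2_set (edge_diff f) F \<le> M" if "finite F" for F
  proof (rule tendsto_upperbound)
    show "(\<lambda>n. L2_set (edge_diff (g n)) F) \<longlonglongrightarrow> L2_set (edge_diff f) F"
      unfolding L2_set_def edge_diff_def by (intro tendsto_intros assms(2))
    show "\<forall>\<^sub>F n in sequentially. L2_set (edge_diff (g n)) F \<le> M"
      using assms(3) by eventually_elim (use L2_set_le_seminorm[OF assms(1) that] order_trans in blast)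
  qed simp
  from seminorm_leI[OF this] show "f \<in> finite_energy b" "seminorm f \<le> M"
    by auto
qed

lemma edge_diff_le_seminorm:
  assumes "f \<in> finite_energy b"
  shows "\<bar>edge_diff f p\<bar> \<le> seminorm f"
  using L2_set_le_seminorm[OF assms, of "{p}"] by (simp add: L2_set_def)

text \<open>\<open>edge_diff\<close> is linear in the function, so this is the scalar parallelogram
  identity summed over all pairs.\<close>

lemma seminorm_parallelogram:
  assumes "f \<in> finite_energy b" "g \<in> finite_energy b"
  shows "(seminorm (\<lambda>x. f x + g x))\<^sup>2 + (seminorm (\<lambda>x. f x - g x))\<^sup>2 = 2 * (seminorm f)\<^sup>2 + 2 * (seminorm g)\<^sup>2"
proof -
  have s: "(\<lambda>p. (edge_diff f p)\<^sup>2) summable_on UNIV" "(\<lambda>p. (edge_diff g p)\<^sup>2) summable_on UNIV"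
    "(\<lambda>p. (edge_diff (\<lambda>x. f x + g x) p)\<^sup>2) summable_on UNIV" "(\<lambda>p. (edge_diff (\<lambda>x. f x - g x) p)\<^sup>2) summable_on UNIV"
    using assms seminorm_triangle seminorm_diff by (auto simp: finite_energy_iff[symmetric])
  have "(seminorm (\<lambda>x. f x + g x))\<^sup>2 + (seminorm (\<lambda>x. f x - g x))\<^sup>2
      = (\<Sum>\<^sub>\<infinity>p. (edge_diff (\<lambda>x. f x + g x) p)\<^sup>2 + (edge_diff (\<lambda>x. f x - g x) p)\<^sup>2)"
    unfolding seminorm_square by (rule infsum_add[symmetric]) (use s in auto)
  also have "\<dots> = (\<Sum>\<^sub>\<infinity>p. 2 * (edge_diff f p)\<^sup>2 + 2 * (edge_diff g p)\<^sup>2)"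
    by (rule infsum_cong) (simp add: edge_diff_def power2_eq_square algebra_simps)
  also have "\<dots> = (\<Sum>\<^sub>\<infinity>p. 2 * (edge_diff f p)\<^sup>2) + (\<Sum>\<^sub>\<infinity>p. 2 * (edge_diff g p)\<^sup>2)"
    by (rule infsum_add) (use s in \<open>auto intro!: summable_on_cmult_right\<close>)
  finally show ?thesis
    by (simp add: seminorm_square infsum_cmult_right')
qed

text \<open>Such a function is a finite linear combination of indicators of vertices, which have
  finite energy because all vertex degrees are finite.\<close>

lemma finite_support_finite_energy:
  assumes "f \<in> finite_support"
  shows "f \<in> finite_energy b"
proof -
  have *: "(\<lambda>x. \<Sum>u\<in>A. f u * (if x = u then 1 else 0)) \<in> finite_energy b" if "finite A" for A
    using that
  proof (induction A)
    case empty
    show ?case by (simp add: finite_energy_const)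
  next
    case (insert u A)
    have "(\<lambda>x. f u * (if x = u then 1 else 0) + (\<Sum>u\<in>A. f u * (if x = u then 1 else 0))) \<in> finite_energy b"
      by (intro seminorm_triangle(1) seminorm_scale(1)[where c = "f u"] finite_energy_indicator weighted insert.IH)
    then show ?case using insert.hyps by simp
  qed
  have "f = (\<lambda>x. \<Sum>u\<in>{x. f x \<noteq> 0}. f u * (if x = u then 1 else 0))"
    using assms by (auto simp: finite_support_def sum.delta if_distrib cong: if_cong)
  with *[of "{x. f x \<noteq> 0}"] assms show ?thesis
    by (metis (mono_tags, lifting) finite_support_def mem_Collect_eq)
qed

section \<open>The Laplacian and the first variation of the energy\<close>

lemma laplacian_summable:
  assumes "f \<in> finite_energy b"
  shows "(\<lambda>y. b x y * \<bar>f y\<bar>) summable_on UNIV"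
    and "(\<lambda>y. b x y * (f x - f y)) summable_on UNIV"
proof -
  have "(\<lambda>p. (edge_diff f p)\<^sup>2) summable_on range (Pair x)"
    using assms unfolding finite_energy_iff by (rule summable_on_subset_banach) simp
  then have sq: "(\<lambda>y. b x y * (f x - f y)\<^sup>2) summable_on UNIV"
    by (subst (asm) summable_on_reindex) (auto simp: inj_on_def o_def edge_diff_square)
  \<comment> \<open>As |t| <= 1 + t^2, the finite degree of \<open>x\<close> and the energy of the
    edges at \<open>x\<close> together dominate the absolute differences.\<close>
  have "(\<lambda>y. b x y * (1 + (f x - f y)\<^sup>2)) summable_on UNIV"
    using summable_on_add[OF b_summable[of x] sq] by (simp add: algebra_simps)
  then have *: "(\<lambda>y. b x y * \<bar>f x - f y\<bar>) summable_on UNIV"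
  proof (rule summable_on_comparison_test)
    show "b x y * \<bar>f x - f y\<bar> \<le> b x y * (1 + (f x - f y)\<^sup>2)" for y
    proof (rule mult_left_mono[OF _ b_nonneg])
      have "\<bar>f x - f y\<bar> \<le> 2 * 1 * \<bar>f x - f y\<bar>" by simp
      also have "\<dots> \<le> 1\<^sup>2 + \<bar>f x - f y\<bar>\<^sup>2" by (rule sum_squares_bound)
      finally show "\<bar>f x - f y\<bar> \<le> 1 + (f x - f y)\<^sup>2" by simp
    qed
  qed (simp_all add: b_nonneg)
  have "(\<lambda>y. b x y * \<bar>f x - f y\<bar> + \<bar>f x\<bar> * b x y) summable_on UNIV"
    using * b_summable[of x] by (intro summable_on_add summable_on_cmult_right)
  then show "(\<lambda>y. b x y * \<bar>f y\<bar>) summable_on UNIV"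
  proof (rule summable_on_comparison_test)
    show "b x y * \<bar>f y\<bar> \<le> b x y * \<bar>f x - f y\<bar> + \<bar>f x\<bar> * b x y" for y
    proof -
      have "b x y * \<bar>f y\<bar> \<le> b x y * (\<bar>f x - f y\<bar> + \<bar>f x\<bar>)"
        by (intro mult_left_mono b_nonneg) linarith
      then show ?thesis by (simp add: algebra_simps)
    qed
  qed (simp_all add: b_nonneg)
  show "(\<lambda>y. b x y * (f x - f y)) summable_on UNIV"
    by (rule abs_summable_summable) (use * b_nonneg in \<open>simp add: abs_mult\<close>)
qed

text \<open>Only pairs containing \<open>u\<close> change their contribution. Each edge at
  \<open>u\<close> is counted in both orientations, whence the outer factor 2.\<close>

lemma seminorm_perturb:
  assumes "h \<in> finite_energy b"
  shows "(seminorm (\<lambda>x. h x + t * (if x = u then 1 else 0)))\<^sup>2 =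
    (seminorm h)\<^sup>2 + 2 * (2 * t * (\<Sum>\<^sub>\<infinity>y. b u y * (h u - h y)) + t\<^sup>2 * (\<Sum>\<^sub>\<infinity>y. b u y))"
proof -
  define g where "g = (\<lambda>x. h x + t * (if x = u then 1 else 0))"
  define k where "k p = (edge_diff g p)\<^sup>2 - (edge_diff h p)\<^sup>2" for p
  define w where "w y = b u y * (2 * t * (h u - h y) + t\<^sup>2)" for y
  have g: "g \<in> finite_energy b"
    unfolding g_def
    by (intro seminorm_triangle(1)[OF assms] seminorm_scale(1) finite_energy_indicator weighted)
  have sk: "k summable_on UNIV"
    using summable_on_add[of "\<lambda>p. (edge_diff g p)\<^sup>2" UNIV "\<lambda>p. - (edge_diff h p)\<^sup>2"] g assms
    by (simp add: finite_energy_iff summable_on_uminus k_def[abs_def])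
  have g_simps: "g u = h u + t" "\<And>y. y \<noteq> u \<Longrightarrow> g y = h y" by (auto simp: g_def)
  have k1: "k (u, y) = w y" for y
  proof (cases "y = u")
    case False
    have "k (u, y) = b u y * (g u - g y)\<^sup>2 - b u y * (h u - h y)\<^sup>2"
      by (simp only: k_def edge_diff_square power2_abs)
    then show ?thesis using False by (simp add: g_simps w_def power2_eq_square algebra_simps)
  qed (simp add: k_def edge_diff_square w_def b_diag)
  have k2: "k (y, u) = w y" for y
    unfolding k1[symmetric] by (simp only: k_def edge_diff_square b_sym[of y u] abs_minus_commute)
  have k0: "k (x, y) = 0" if "x \<noteq> u" "y \<noteq> u" for x y
    using that by (simp add: k_def edge_diff_def g_def)
  have w0: "w u = 0" by (simp add: w_def b_diag)
  \<comment> \<open>These are the two orientations of the star at \<open>u\<close>. Leaving the pair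
    \<open>(u, u)\<close> out of \<open>B\<close> makes them disjoint and does not alter the sum,
    since \<open>w u = 0\<close>.\<close>
  define A B where "A = range (\<lambda>y::'v. (u, y))" and "B = (\<lambda>y. (y, u)) ` (UNIV - {u})"
  have "infsum k UNIV = infsum k (A \<union> B)"
  proof (rule infsum_cong_neutral)
    fix p assume "p \<in> UNIV - (A \<union> B)"
    then show "k p = 0" using k0[of "fst p" "snd p"] by (cases p) (auto simp: A_def B_def image_iff)
  qed auto
  also have "\<dots> = infsum k A + infsum k B"
    by (rule infsum_Un_disjoint; (rule summable_on_subset_banach[OF sk])?) (auto simp: A_def B_def)
  also have "infsum k A = infsum w UNIV"
    unfolding A_def by (subst infsum_reindex) (auto simp: inj_on_def o_def k1)
  also have "infsum k B = infsum w (UNIV - {u})"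
    unfolding B_def by (subst infsum_reindex) (auto simp: inj_on_def o_def k2)
  also have "infsum w (UNIV - {u}) = infsum w UNIV"
    by (rule infsum_cong_neutral) (auto simp: w0)
  finally have ik: "infsum k UNIV = 2 * infsum w UNIV" by simp
  have "infsum w UNIV = (\<Sum>\<^sub>\<infinity>y. 2 * t * (b u y * (h u - h y)) + t\<^sup>2 * b u y)"
    by (rule infsum_cong) (simp add: w_def algebra_simps)
  also have "\<dots> = (\<Sum>\<^sub>\<infinity>y. 2 * t * (b u y * (h u - h y))) + (\<Sum>\<^sub>\<infinity>y. t\<^sup>2 * b u y)"
    by (intro infsum_add summable_on_cmult_right laplacian_summable[OF assms] b_summable)
  also have "\<dots> = 2 * t * (\<Sum>\<^sub>\<infinity>y. b u y * (h u - h y)) + t\<^sup>2 * (\<Sum>\<^sub>\<infinity>y. b u y)"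
    by (simp add: infsum_cmult_right')
  finally have iw: "infsum w UNIV = \<dots>" .
  have "(seminorm g)\<^sup>2 = (\<Sum>\<^sub>\<infinity>p. (edge_diff h p)\<^sup>2 + k p)"
    by (simp add: seminorm_square k_def)
  also have "\<dots> = (seminorm h)\<^sup>2 + infsum k UNIV"
    unfolding seminorm_square using assms sk by (intro infsum_add) (simp_all add: finite_energy_iff)
  finally have "(seminorm g)\<^sup>2 = (seminorm h)\<^sup>2 + infsum k UNIV" .
  then show ?thesis using ik iw by (simp add: g_def)
qed

text \<open>By \<open>seminorm_perturb\<close> the squared seminorm is a quadratic polynomial in
  \<open>t\<close> whose linear coefficient is a multiple of the Laplacian at \<open>u\<close>;
  minimality at \<open>t = 0\<close> forces this coefficient to vanish.\<close>

lemma harmonic_if_minimal: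
  assumes h: "h \<in> finite_energy b"
    and min: "\<And>u t. seminorm h \<le> seminorm (\<lambda>x. h x + t * (if x = u then 1 else 0))"
  shows "harmonic b h"
  unfolding harmonic_def
proof (intro conjI allI)
  fix u
  show "(\<lambda>y. b u y * \<bar>h y\<bar>) summable_on UNIV" by (rule laplacian_summable[OF h])
  define S d where "S = (\<Sum>\<^sub>\<infinity>y. b u y * (h u - h y))" and "d = (\<Sum>\<^sub>\<infinity>y. b u y)"
  have d: "d \<ge> 0" unfolding d_def by (rule infsum_nonneg) (rule b_nonneg)
  \<comment> \<open>The quadratic is minimal at \<open>- S / d\<close>; the denominator
    \<open>d + 1\<close> is positive even for degree 0 and still makes the increment at most 0, with
    equality only for \<open>S = 0\<close>.\<close>
  define t where "t = - S / (d + 1)"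
  have td: "t * (d + 1) = - S" using d by (simp add: t_def)
  have "(seminorm h)\<^sup>2 \<le> (seminorm (\<lambda>x. h x + t * (if x = u then 1 else 0)))\<^sup>2"
    by (intro power_mono min) simp
  then have "0 \<le> 2 * t * S + t\<^sup>2 * d"
    unfolding seminorm_perturb[OF h] S_def d_def by simp
  also have "\<dots> = - t\<^sup>2 * (d + 2)"
  proof -
    have S: "S = - (t * (d + 1))" using td by simp
    show ?thesis by (subst S) (simp add: power2_eq_square algebra_simps)
  qed
  finally have "t\<^sup>2 * (d + 2) \<le> 0" by simp
  then have "t = 0" using d by (simp add: mult_le_0_iff)
  then show "(\<Sum>\<^sub>\<infinity>y. b u y * (h u - h y)) = 0" using td by (simp add: S_def)
qed

section \<open>The closure of the finitely supported functions and recurrence\<close>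

lemma finite_energy0_iff:
  "f \<in> finite_energy0 b r \<longleftrightarrow> f \<in> finite_energy b \<and>
    (\<forall>\<epsilon>>0. \<exists>g\<in>finite_support. seminorm (\<lambda>x. f x - g x) < \<epsilon> \<and> \<bar>f r - g r\<bar> < \<epsilon>)"
proof (cases "f \<in> finite_energy b")
  case f: True
  have norm_eq: "energy_norm b r (\<lambda>x. f x - g x) = sqrt ((seminorm (\<lambda>x. f x - g x))\<^sup>2 / 2 + \<bar>f r - g r\<bar>\<^sup>2)"
    if "g \<in> finite_support" for g
    using seminorm_diff(1)[OF f finite_support_finite_energy[OF that]]
    by (simp add: energy_norm_def enn2real_energy)
  \<comment> \<open>These inequalities show that \<open>energy_norm\<close> is equivalent to the sum
    of the seminorm and the value at \<open>r\<close>, so both describe the same closure.\<close>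
  have 1: "seminorm (\<lambda>x. f x - g x) \<le> 2 * energy_norm b r (\<lambda>x. f x - g x)" 
      "\<bar>f r - g r\<bar> \<le> energy_norm b r (\<lambda>x. f x - g x)"
      "energy_norm b r (\<lambda>x. f x - g x) \<le> seminorm (\<lambda>x. f x - g x) + \<bar>f r - g r\<bar>"
    if g: "g \<in> finite_support" for g
  proof -
    define s t where "s = seminorm (\<lambda>x. f x - g x)" and "t = f r - g r"
    have s: "s \<ge> 0" by (simp add: s_def)
    have "s / 2 \<le> sqrt (s\<^sup>2 / 2 + \<bar>t\<bar>\<^sup>2)"
      by (rule real_le_rsqrt) (simp add: power_divide add_increasing2)
    moreover have "\<bar>t\<bar> \<le> sqrt (s\<^sup>2 / 2 + \<bar>t\<bar>\<^sup>2)"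
      by (rule real_le_rsqrt) simp
    moreover have "sqrt (s\<^sup>2 / 2 + \<bar>t\<bar>\<^sup>2) \<le> s + \<bar>t\<bar>"
      using s by (intro real_le_lsqrt) (auto simp: power2_sum add_increasing2)
    ultimately show "seminorm (\<lambda>x. f x - g x) \<le> 2 * energy_norm b r (\<lambda>x. f x - g x)" 
      "\<bar>f r - g r\<bar> \<le> energy_norm b r (\<lambda>x. f x - g x)"
      "energy_norm b r (\<lambda>x. f x - g x) \<le> seminorm (\<lambda>x. f x - g x) + \<bar>f r - g r\<bar>"
      unfolding norm_eq[OF g] s_def t_def by linarith+
  qed
  show ?thesis
  proof
    assume f0: "f \<in> finite_energy0 b r"
    have "\<exists>g\<in>finite_support. seminorm (\<lambda>x. f x - g x) < \<epsilon> \<and> \<bar>f r - g r\<bar> < \<epsilon>" if \<epsilon>: "\<epsilon> > 0" for \<epsilon> :: real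
    proof -
      obtain g where g: "g \<in> finite_support" "energy_norm b r (\<lambda>x. f x - g x) < \<epsilon> / 2"
        using f0 \<epsilon> unfolding finite_energy0_def mem_Collect_eq by (meson half_gt_zero)
      then show ?thesis using 1[OF g(1)] \<epsilon> by (intro bexI[of _ g]) auto
    qed
    then show "f \<in> finite_energy b \<and>
      (\<forall>\<epsilon>>0. \<exists>g\<in>finite_support. seminorm (\<lambda>x. f x - g x) < \<epsilon> \<and> \<bar>f r - g r\<bar> < \<epsilon>)"
      using f by blast
  next
    assume *: "f \<in> finite_energy b \<and>
      (\<forall>\<epsilon>>0. \<exists>g\<in>finite_support. seminorm (\<lambda>x. f x - g x) < \<epsilon> \<and> \<bar>f r - g r\<bar> < \<epsilon>)"
    have "\<exists>g\<in>finite_support. energy_norm b r (\<lambda>x. f x - g x) < \<epsilon>" if \<epsilon>: "\<epsilon> > 0" for \<epsilon> :: real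
    proof -
      obtain g where g: "g \<in> finite_support" "seminorm (\<lambda>x. f x - g x) < \<epsilon> / 2" "\<bar>f r - g r\<bar> < \<epsilon> / 2"
        using conjunct2[OF *] half_gt_zero[OF \<epsilon>] by blast
      then show ?thesis using 1(3)[OF g(1)] by (intro bexI[of _ g]) auto
    qed
    then show "f \<in> finite_energy0 b r"
      using f by (simp add: finite_energy0_def)
  qed
qed (simp add: finite_energy0_def)

lemma recurrent_iff: "recurrent b r \<longleftrightarrow> (\<lambda>_. 1) \<in> finite_energy0 b r"
  by (simp add: recurrent_def energy_def case_prod_unfold)

text \<open>If no constant worked, finitely supported functions with value 1 at \<open>r\<close>
  could have arbitrarily small seminorm. They would approximate the constant 1, making the graph
  recurrent.\<close>

lemma transient_imp_value_le_seminorm: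
  assumes "transient b r"
  shows "\<exists>C>0. \<forall>g\<in>finite_support. \<bar>g r\<bar> \<le> C * seminorm g"
proof (rule ccontr)
  assume neg: "\<not> ?thesis"
  have "\<exists>g\<in>finite_support. seminorm (\<lambda>x. 1 - g x) < \<epsilon> \<and> \<bar>1 - g r\<bar> < \<epsilon>" if \<epsilon>: "\<epsilon> > 0" for \<epsilon> :: real
  proof -
    have "1 / \<epsilon> > 0" using \<epsilon> by simp
    with neg have "\<not> (\<forall>g\<in>finite_support. \<bar>g r\<bar> \<le> 1 / \<epsilon> * seminorm g)" by blast
    then obtain g where g: "g \<in> finite_support" "1 / \<epsilon> * seminorm g < \<bar>g r\<bar>"
      by (auto simp: not_le)
    have "0 \<le> 1 / \<epsilon> * seminorm g" using \<epsilon> by simp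
    then have gr: "\<bar>g r\<bar> > 0" using g(2) by linarith
    \<comment> \<open>After normalisation \<open>1 - h\<close> vanishes at \<open>r\<close> and has
      the same seminorm as \<open>h\<close>.\<close>
    define h where "h x = 1 / g r * g x" for x
    have "seminorm h \<le> \<bar>1 / g r\<bar> * seminorm g"
      unfolding h_def using g(1) by (intro seminorm_scale(2) finite_support_finite_energy)
    also have "\<dots> < \<epsilon>" using g(2) gr \<epsilon> by (simp add: field_simps)
    finally have "seminorm h < \<epsilon>" .
    moreover have "h \<in> finite_support" unfolding h_def by (rule finite_support_scale[OF g(1)])
    moreover have "h r = 1" using gr by (simp add: h_def)
    ultimately show ?thesis using \<epsilon> by (intro bexI[of _ h]) (auto simp: seminorm_const_minus)
  qed
  then have "recurrent b r" by (simp add: recurrent_iff finite_energy0_iff finite_energy_const)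
  then show False using assms by (simp add: transient_def)
qed

end

section \<open>Functions vanishing at infinity and the one-point compactification\<close>

lemma vanishing_at_infinity_iff:
  "f \<in> vanishing_at_infinity \<longleftrightarrow> (\<forall>\<epsilon>>0. finite {x. \<bar>f x\<bar> \<ge> \<epsilon>})"
proof
  assume f: "f \<in> vanishing_at_infinity"
  show "\<forall>\<epsilon>>0. finite {x. \<bar>f x\<bar> \<ge> \<epsilon>}"
  proof (intro allI impI)
    fix \<epsilon> :: real assume "\<epsilon> > 0"
    then obtain g where g: "g \<in> finite_support" "sup_norm (\<lambda>x. f x - g x) < \<epsilon>"
      using f by (auto simp: vanishing_at_infinity_def)
    have "range g \<subseteq> insert 0 (g ` {x. g x \<noteq> 0})" by auto
    then have "bounded (range g)"
      using g(1) by (auto simp: finite_support_def intro: finite_imp_bounded finite_subset)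
    \<comment> \<open>Boundedness is what makes the real supremum in \<open>sup_norm\<close> an
      actual upper bound.\<close>
    then have "bounded (range (\<lambda>x. f x - g x))"
      using f by (intro bounded_minus_comp) (auto simp: vanishing_at_infinity_def bounded_functions_def)
    then have "bdd_above (range (\<lambda>x. \<bar>f x - g x\<bar>))"
      by (auto simp: bounded_iff bdd_above_def)
    then have "\<bar>f x - g x\<bar> < \<epsilon>" for x
      using cSUP_upper[of x UNIV "\<lambda>x. \<bar>f x - g x\<bar>"] g(2) by (auto simp: sup_norm_def)
    then have "{x. \<bar>f x\<bar> \<ge> \<epsilon>} \<subseteq> {x. g x \<noteq> 0}"
      by (metis (mono_tags, lifting) Collect_mono diff_zero not_le)
    then show "finite {x. \<bar>f x\<bar> \<ge> \<epsilon>}"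
      using g(1) by (auto simp: finite_support_def intro: finite_subset)
  qed
next
  assume f: "\<forall>\<epsilon>>0. finite {x. \<bar>f x\<bar> \<ge> \<epsilon>}"
  have "range f \<subseteq> f ` {x. \<bar>f x\<bar> \<ge> 1} \<union> {-1..1}" by (force simp: abs_if)
  then have "bounded (range f)"
    using f by (meson bounded_Un bounded_closed_interval bounded_subset finite_imageI finite_imp_bounded zero_less_one)
  moreover have "\<exists>g\<in>finite_support. sup_norm (\<lambda>x. f x - g x) < \<epsilon>" if "\<epsilon> > 0" for \<epsilon>
  proof
    \<comment> \<open>The supremum is only bounded weakly by the cutoff level; cutting at half of it
      yields the strict inequality.\<close>
    define g where "g = (\<lambda>x. if \<bar>f x\<bar> \<ge> \<epsilon> / 2 then f x else 0)"
    have "finite {x. \<bar>f x\<bar> \<ge> \<epsilon> / 2}" using spec[OF f, of "\<epsilon> / 2"] that by simp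
    then show "g \<in> finite_support"
      by (auto simp: finite_support_def g_def elim: rev_finite_subset)
    have "sup_norm (\<lambda>x. f x - g x) \<le> \<epsilon> / 2"
      unfolding sup_norm_def using that by (intro cSUP_least) (auto simp: g_def)
    then show "sup_norm (\<lambda>x. f x - g x) < \<epsilon>" using that by simp
  qed
  ultimately show "f \<in> vanishing_at_infinity"
    by (simp add: vanishing_at_infinity_def bounded_functions_def)
qed

text \<open>\<open>None\<close> is the point at infinity and \<open>Some\<close> embeds the
  vertices.\<close>

abbreviation one_point_space :: "'v option topology" where
  "one_point_space \<equiv> Alexandroff_compactification (discrete_topology UNIV)"

lemma topspace_one_point: "topspace one_point_space = UNIV"
  by (simp add: UNIV_option_conv)

text \<open>Neighbourhoods of infinity are complements of compact sets, and the compact sets of a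
  discrete space are the finite ones.\<close>

lemma openin_one_point_iff:
  "openin one_point_space U \<longleftrightarrow> (None \<in> U \<longrightarrow> finite {x. Some x \<notin> U})"
proof (cases "None \<in> U")
  case False
  then have "U = Some ` {x. Some x \<in> U}" by (auto simp: image_iff) (metis not_None_eq)
  then have "openin one_point_space U"
    by (metis openin_Alexandroff_compactification_image_Some openin_discrete_topology subset_UNIV)
  then show ?thesis using False by simp
next
  case True
  have "U = insert None (Some ` (UNIV - {x. Some x \<notin> U}))"
  proof (rule set_eqI)
    show "p \<in> U \<longleftrightarrow> p \<in> insert None (Some ` (UNIV - {x. Some x \<notin> U}))" for p
      using True by (cases p) auto
  qed
  \<comment> \<open>The compact set in the definition of the topology is determined by
    \<open>U\<close>, so the existential quantifier can be eliminated.\<close>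
  moreover have "C = {x. Some x \<notin> U}" if "U = insert None (Some ` (UNIV - C))" for C
    unfolding that by auto
  moreover have "U \<noteq> Some ` V" for V using True by auto
  ultimately have "openin one_point_space U \<longleftrightarrow> compactin (discrete_topology UNIV) {x. Some x \<notin> U}"
    unfolding openin_Alexandroff_compactification topspace_discrete_topology
    by (metis closedin_discrete_topology subset_UNIV)
  then show ?thesis using True by (simp add: compactin_discrete_topology)
qed

text \<open>All vertices are isolated, so continuity matters only at \<open>None\<close>, where it
  means convergence to \<open>F None\<close> along cofinite sets.\<close>

lemma continuous_map_one_point_iff:
  fixes F :: "'v option \<Rightarrow> real"
  shows "continuous_map one_point_space euclideanreal F \<longleftrightarrow>
    (\<lambda>x. F (Some x) - F None) \<in> vanishing_at_infinity"
proof
  assume F: "continuous_map one_point_space euclideanreal F"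
  have "finite {x. \<bar>F (Some x) - F None\<bar> \<ge> \<epsilon>}" if "\<epsilon> > 0" for \<epsilon>
  proof -
    have "openin one_point_space {p \<in> topspace one_point_space. F p \<in> ball (F None) \<epsilon>}"
      by (rule openin_continuous_map_preimage[OF F]) simp
    then have "finite {x. Some x \<notin> {p. F p \<in> ball (F None) \<epsilon>}}"
      using that unfolding topspace_one_point openin_one_point_iff by simp
    moreover have "{x. Some x \<notin> {p. F p \<in> ball (F None) \<epsilon>}} = {x. \<bar>F (Some x) - F None\<bar> \<ge> \<epsilon>}"
      by (simp add: dist_real_def abs_minus_commute not_less)
    ultimately show ?thesis by simp
  qed
  then show "(\<lambda>x. F (Some x) - F None) \<in> vanishing_at_infinity"
    by (simp add: vanishing_at_infinity_iff)
next
  assume F: "(\<lambda>x. F (Some x) - F None) \<in> vanishing_at_infinity"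
  have "openin one_point_space {p. F p \<in> U}" if U: "open U" for U
    unfolding openin_one_point_iff
  proof
    assume "None \<in> {p. F p \<in> U}"
    then obtain \<epsilon> where \<epsilon>: "\<epsilon> > 0" "ball (F None) \<epsilon> \<subseteq> U"
      using openE[OF U, of "F None"] by auto
    have "F (Some x) \<in> U" if "\<not> \<bar>F (Some x) - F None\<bar> \<ge> \<epsilon>" for x
      using that by (intro subsetD[OF \<epsilon>(2)]) (simp add: dist_real_def abs_minus_commute)
    then have "{x. Some x \<notin> {p. F p \<in> U}} \<subseteq> {x. \<bar>F (Some x) - F None\<bar> \<ge> \<epsilon>}" by blast
    then show "finite {x. Some x \<notin> {p. F p \<in> U}}"
      by (rule finite_subset) (use F \<epsilon>(1) in \<open>simp add: vanishing_at_infinity_iff\<close>)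
  qed
  then show "continuous_map one_point_space euclideanreal F"
    unfolding continuous_map_def topspace_one_point by simp
qed

text \<open>The limit \<open>c\<close> serves as the value of the extension at \<open>None\<close>;
  density of the vertices gives uniqueness, and indicators of vertices separate points.\<close>

lemma Royden_compactification_one_point:
  fixes b :: "'v \<Rightarrow> 'v \<Rightarrow> real"
  assumes "weighted_graph b" "infinite (UNIV :: 'v set)"
    and lim: "\<And>f. f \<in> finite_energy b \<inter> bounded_functions \<Longrightarrow> \<exists>c. (\<lambda>x. f x - c) \<in> vanishing_at_infinity"
  shows "is_Royden_compactification b one_point_space Some"
proof -
  have ext: "continuous_extension one_point_space Some f (case_option c f)"
    if "(\<lambda>x. f x - c) \<in> vanishing_at_infinity" for f :: "'v \<Rightarrow> real" and c
    using that by (simp only: continuous_extension_def topspace_one_point continuous_map_one_point_iff extensional_UNIV option.case) simp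
  \<comment> \<open>An infinite discrete space is not compact, so infinity is not isolated.\<close>
  have dense: "one_point_space closure_of (range Some) = (UNIV :: 'v option set)"
    using Alexandroff_compactification_dense[of "discrete_topology (UNIV :: 'v set)"] assms(2)
    unfolding topspace_one_point by (simp add: compact_space_discrete_topology)
  have uniq: "F = G" if "continuous_extension one_point_space Some f F"
    "continuous_extension one_point_space Some f G" for f :: "'v \<Rightarrow> real" and F G
  proof
    fix p :: "'v option"
    have "p \<in> one_point_space closure_of (range Some)" by (simp add: dense)
    then show "F p = G p"
      by (rule forall_in_closure_of_eq[where Y = euclideanreal])
        (use that in \<open>auto simp: continuous_extension_def\<close>)
  qed
  have sep: "\<exists>f \<in> finite_energy b \<inter> bounded_functions. \<exists>F. continuous_extension one_point_space Some f F \<and> F p \<noteq> F q"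
    if pq: "p \<noteq> q" for p q :: "'v option"
  proof -
    \<comment> \<open>Of two distinct points at least one is a vertex, and its indicator tells them
      apart.\<close>
    obtain u where u: "p = Some u \<or> q = Some u" using pq by (cases p; cases q) auto
    define e where "e x = (if x = u then 1 else (0::real))" for x
    have "{x. \<bar>e x - 0\<bar> \<ge> \<epsilon>} \<subseteq> {u}" if "\<epsilon> > 0" for \<epsilon> using that by (auto simp: e_def split: if_splits)
    then have "(\<lambda>x. e x - 0) \<in> vanishing_at_infinity"
      unfolding vanishing_at_infinity_iff by (blast intro: finite_subset[of _ "{u}"])
    then have "continuous_extension one_point_space Some e (case_option 0 e)" by (rule ext)
    moreover have "e \<in> finite_energy b"
      unfolding e_def by (rule finite_energy_indicator[OF assms(1)])
    moreover have "e \<in> bounded_functions"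
      by (auto simp: bounded_functions_def bounded_iff e_def intro!: exI[of _ 1])
    moreover have "case_option 0 e p \<noteq> case_option 0 e q"
      using u pq by (auto simp: e_def split: option.splits)
    ultimately show ?thesis by blast
  qed
  show ?thesis
    unfolding is_Royden_compactification_def
  proof (intro conjI ballI impI)
    show "Hausdorff_space (one_point_space :: 'v option topology)"
      by (simp add: Hausdorff_space_Alexandroff_compactification Hausdorff_space_discrete_topology
          locally_compact_space_discrete_topology)
    show "openin one_point_space (range (Some :: 'v \<Rightarrow> _))" by simp
    show "\<exists>!F. continuous_extension one_point_space Some f F" if "f \<in> finite_energy b \<inter> bounded_functions" for f
      using lim[OF that] ext uniq by metis
  qed (simp_all only: dense topspace_one_point embedding_map_Some compact_space_Alexandroff_compactification, rule sep)
qed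

text \<open>The extension of \<open>f\<close>, transported by the homeomorphism, is continuous at
  \<open>None\<close>; its value there is the limit.\<close>

lemma one_point_compactification_imp_limit:
  fixes b :: "'v \<Rightarrow> 'v \<Rightarrow> real"
  assumes R: "is_Royden_compactification b R i" and one: "is_one_point_compactification R i"
    and f: "f \<in> finite_energy b \<inter> bounded_functions"
  shows "\<exists>c. (\<lambda>x. f x - c) \<in> vanishing_at_infinity"
proof -
  obtain h where h: "homeomorphic_map R one_point_space h" "\<And>x. h (i x) = Some x"
    using one unfolding is_one_point_compactification_def by blast
  then obtain k where k: "homeomorphic_maps R one_point_space h k"
    by (auto simp: homeomorphic_map_maps)
  obtain F where F: "continuous_map R euclideanreal F" "\<And>x. F (i x) = f x"
    using R f unfolding is_Royden_compactification_def continuous_extension_def by blast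
  have "i x \<in> topspace R" for x
    using R openin_subset by (fastforce simp: is_Royden_compactification_def)
  then have ki: "k (Some x) = i x" for x
    using k h(2) by (metis homeomorphic_maps_def)
  have "continuous_map one_point_space R k"
    using k by (simp add: homeomorphic_maps_def)
  then have "continuous_map one_point_space euclideanreal (F \<circ> k)"
    using F(1) by (rule continuous_map_compose)
  then show ?thesis
    by (auto simp: continuous_map_one_point_iff ki F(2))
qed

section \<open>Connected graphs: pointwise and uniform bounds by the energy\<close>

locale connected_energy_graph = energy_graph b for b :: "'v \<Rightarrow> 'v \<Rightarrow> real" +
  assumes connected: "connected_graph b"
begin

text \<open>Across an edge of a path the difference is at most the seminorm divided by the root of
  the weight; adding these up gives a constant that depends on the path alone.\<close>

lemma increment_le_seminorm:
  "\<exists>C\<ge>0. \<forall>f\<in>finite_energy b. \<bar>f x - f y\<bar> \<le> C * seminorm f"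
proof (cases "x = y")
  case True
  then show ?thesis by (intro exI[of _ 0]) auto
next
  case False
  then obtain n :: nat and p where p: "p 0 = x" "p n = y" "\<And>i. i \<in> {1..n} \<Longrightarrow> b (p (i - 1)) (p i) > 0"
    using connected unfolding connected_graph_def by metis
  have "\<exists>C\<ge>0. \<forall>f\<in>finite_energy b. \<bar>f (p 0) - f (p k)\<bar> \<le> C * seminorm f" if "k \<le> n" for k
    using that
  proof (induction k)
    case 0
    then show ?case by (intro exI[of _ 0]) auto
  next
    case (Suc k)
    then obtain C where C: "C \<ge> 0" "\<And>f. f \<in> finite_energy b \<Longrightarrow> \<bar>f (p 0) - f (p k)\<bar> \<le> C * seminorm f"
      by auto
    define w where "w = sqrt (b (p k) (p (Suc k)))"
    have w: "w > 0" using p(3)[of "Suc k"] Suc.prems by (simp add: w_def)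
    have "\<bar>f (p 0) - f (p (Suc k))\<bar> \<le> (C + 1 / w) * seminorm f" if f: "f \<in> finite_energy b" for f
    proof -
      have "w * \<bar>f (p k) - f (p (Suc k))\<bar> \<le> seminorm f"
        using edge_diff_le_seminorm[OF f, of "(p k, p (Suc k))"] w
        by (simp add: edge_diff_def w_def abs_mult)
      then have "\<bar>f (p k) - f (p (Suc k))\<bar> \<le> 1 / w * seminorm f"
        using w by (simp add: field_simps)
      then show ?thesis using C(2)[OF f] by (simp add: algebra_simps)
    qed
    then show ?case using C(1) w by (intro exI[of _ "C + 1 / w"]) auto
  qed
  from this[of n] show ?thesis using p by simp
qed

text \<open>A gliding hump: otherwise a sum of nonnegative functions with summable norms but large
  values would be an unbounded function of finite energy.\<close>

lemma canonically_compactifiable_imp_sup_bound: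
  assumes "canonically_compactifiable b"
  shows "\<exists>C>0. \<forall>f\<in>finite_energy b. \<forall>x. \<bar>f x\<bar> \<le> C * (seminorm f + \<bar>f r\<bar>)"
proof (rule ccontr)
  assume neg: "\<not> ?thesis"
  \<comment> \<open>The factor \<open>2 ^ n\<close> will make the normalised norms summable, while
    \<open>real (Suc n)\<close> remains as a lower bound for the value at one vertex.\<close>
  have "\<exists>f x. f \<in> finite_energy b \<and> real (Suc n) * 2 ^ n * (seminorm f + \<bar>f r\<bar>) < \<bar>f x\<bar>" for n
  proof -
    have "real (Suc n) * 2 ^ n > 0" by simp
    with neg have "\<not> (\<forall>f\<in>finite_energy b. \<forall>x. \<bar>f x\<bar> \<le> real (Suc n) * 2 ^ n * (seminorm f + \<bar>f r\<bar>))" by blast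
    then show ?thesis by (auto simp: not_le simp del: of_nat_Suc)
  qed
  then obtain f z where f: "\<And>n. f n \<in> finite_energy b"
    and fz: "\<And>n. real (Suc n) * 2 ^ n * (seminorm (f n) + \<bar>f n r\<bar>) < \<bar>f n (z n)\<bar>"
    by metis
  define N where "N n = seminorm (f n) + \<bar>f n r\<bar>" for n
  \<comment> \<open>If the norm were 0, then \<open>f n\<close> would vanish at \<open>r\<close> and
    be constant, contradicting \<open>fz\<close>.\<close>
  have N: "N n > 0" for n
  proof (rule ccontr)
    assume "\<not> N n > 0"
    then have 0: "seminorm (f n) = 0" "f n r = 0"
      using seminorm_nonneg[of "f n"] abs_ge_zero[of "f n r"] unfolding N_def by linarith+
    then have "f n (z n) = 0"
      using increment_le_seminorm[of "z n" r] f[of n] by auto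
    then show False using fz[of n] 0 by simp
  qed
  \<comment> \<open>Absolute values prevent cancellation between the humps and do not increase the
    seminorm.\<close>
  define h where "h n x = 1 / (2 ^ n * N n) * \<bar>f n x\<bar>" for n x
  have h0: "h n x \<ge> 0" for n x using N[of n] by (simp add: h_def)
  have hc: "\<bar>h n x - h n y\<bar> \<le> 1 / (2 ^ n * N n) * \<bar>f n x - f n y\<bar>" for n x y
  proof -
    have "h n x - h n y = 1 / (2 ^ n * N n) * (\<bar>f n x\<bar> - \<bar>f n y\<bar>)"
      by (simp add: h_def right_diff_distrib)
    then show ?thesis
      using N[of n] by (simp add: abs_mult divide_right_mono abs_triangle_ineq3)
  qed
  have hD: "h n \<in> finite_energy b" and hs': "seminorm (h n) \<le> 1 / (2 ^ n * N n) * seminorm (f n)" for n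
    using seminorm_contraction[OF f hc] N[of n] by auto
  have hs: "seminorm (h n) + h n r \<le> (1 / 2) ^ n" for n
  proof -
    have "seminorm (h n) + h n r \<le> 1 / (2 ^ n * N n) * N n"
      using hs'[of n] by (simp add: h_def N_def algebra_simps add_divide_distrib)
    then show ?thesis using N[of n] by (simp add: power_one_over)
  qed
  have "summable (\<lambda>n. h n x)" for x
  proof -
    obtain C where C: "C \<ge> 0" "\<And>f. f \<in> finite_energy b \<Longrightarrow> \<bar>f x - f r\<bar> \<le> C * seminorm f"
      using increment_le_seminorm by blast
    \<comment> \<open>The increment bound carries the geometric decay from \<open>r\<close> to
      \<open>x\<close>.\<close>
    have "norm (h n x) \<le> (C + 1) * (1 / 2) ^ n" for n
    proof -
      have "h n x \<le> h n r + C * seminorm (h n)" using C(2)[OF hD, of n] by linarith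
      also have "\<dots> \<le> (C + 1) * (seminorm (h n) + h n r)"
        using C(1) h0[of n r] seminorm_nonneg[of "h n"] by (simp add: algebra_simps)
      also have "\<dots> \<le> (C + 1) * (1 / 2) ^ n" using hs[of n] C(1) by (intro mult_left_mono) auto
      finally show ?thesis using h0[of n x] by simp
    qed
    moreover have "summable (\<lambda>n. (C + 1) * (1 / 2 :: real) ^ n)"
      by (intro summable_mult summable_geometric) simp
    ultimately show ?thesis by (rule summable_comparison_test'[rotated])
  qed
  note sm = this
  have part: "(\<lambda>x. \<Sum>n<m. h n x) \<in> finite_energy b \<and> seminorm (\<lambda>x. \<Sum>n<m. h n x) \<le> (\<Sum>n<m. (1 / 2) ^ n)" for m
  proof (induction m)
    case 0
    have "seminorm (\<lambda>_. 0) = 0" by (simp add: seminorm_def edge_diff_def)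
    then show ?case by (simp add: finite_energy_const)
  next
    case (Suc m)
    have "seminorm (h m) \<le> (1 / 2) ^ m" using hs[of m] h0[of m r] by simp
    moreover have "seminorm (\<lambda>x. \<Sum>n<Suc m. h n x) \<le> seminorm (\<lambda>x. \<Sum>n<m. h n x) + seminorm (h m)"
      using seminorm_triangle(2)[OF conjunct1[OF Suc] hD[of m]] by simp
    moreover have "(\<lambda>x. \<Sum>n<Suc m. h n x) \<in> finite_energy b"
      using seminorm_triangle(1)[OF conjunct1[OF Suc] hD[of m]] by simp
    ultimately show ?case
      using Suc unfolding sum.lessThan_Suc by linarith
  qed
  define F where "F x = (\<Sum>n. h n x)" for x
  \<comment> \<open>Lower semicontinuity applies to the partial sums, whose seminorms are bounded by
    the geometric sum 2.\<close>
  have "F \<in> finite_energy b"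
  proof (rule seminorm_lower_semicontinuous(1)[of "\<lambda>m x. \<Sum>n<m. h n x" F 2])
    show "(\<lambda>m. \<Sum>n<m. h n x) \<longlonglongrightarrow> F x" for x
      unfolding F_def using sm[of x] by (rule summable_LIMSEQ)
    have geo: "(\<Sum>n<m. (1 / 2 :: real) ^ n) \<le> 2" for m
      by (simp add: sum_gp_strict)
    show "\<forall>\<^sub>F m in sequentially. seminorm (\<lambda>x. \<Sum>n<m. h n x) \<le> 2"
      by (intro always_eventually allI order_trans[OF conjunct2[OF part] geo])
  qed (simp add: part)
  then have "bounded (range F)"
    using assms by (auto simp: canonically_compactifiable_def bounded_functions_def)
  then obtain B where B: "\<And>x. \<bar>F x\<bar> \<le> B" by (auto simp: bounded_iff)
  obtain n :: nat where n: "B < real n" using reals_Archimedean2 by blast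
  have "real (Suc n) * (2 ^ n * N n) < \<bar>f n (z n)\<bar>"
    using fz[of n] by (simp only: N_def mult.assoc)
  then have "real (Suc n) < \<bar>f n (z n)\<bar> / (2 ^ n * N n)"
    using N[of n] by (subst pos_less_divide_eq) simp_all
  then have "real (Suc n) < h n (z n)"
    by (simp add: h_def)
  also have "\<dots> \<le> F (z n)"
    unfolding F_def using sum_le_suminf[OF sm, of "{n}" "z n"] h0 by simp
  finally show False using B[of "z n"] n by simp
qed

text \<open>By the supremum bound, approximation in norm by finitely supported functions is uniform
  approximation.\<close>

lemma canonically_compactifiable_imp_uniformly_transient:
  assumes "canonically_compactifiable b"
  shows "uniformly_transient b r"
  unfolding uniformly_transient_def
proof
  fix f assume f: "f \<in> finite_energy0 b r"
  obtain C where C: "C > 0" "\<And>f x. f \<in> finite_energy b \<Longrightarrow> \<bar>f x\<bar> \<le> C * (seminorm f + \<bar>f r\<bar>)"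
    using canonically_compactifiable_imp_sup_bound[OF assms, of r] by blast
  have "finite {x. \<bar>f x\<bar> \<ge> \<epsilon>}" if "\<epsilon> > 0" for \<epsilon>
  proof -
    \<comment> \<open>Both the seminorm and the value at \<open>r\<close> contribute less than
      \<open>\<delta>\<close>, so each gets half of \<open>\<epsilon> / C\<close>.\<close>
    define \<delta> where "\<delta> = \<epsilon> / (2 * C)"
    have \<delta>: "\<delta> > 0" "C * (\<delta> + \<delta>) = \<epsilon>" using that C(1) by (simp_all add: \<delta>_def)
    have fD: "f \<in> finite_energy b"
      and "\<forall>\<delta>>0. \<exists>g\<in>finite_support. seminorm (\<lambda>x. f x - g x) < \<delta> \<and> \<bar>f r - g r\<bar> < \<delta>"
      using f by (simp_all add: finite_energy0_iff)
    then obtain g where g: "g \<in> finite_support" "seminorm (\<lambda>x. f x - g x) < \<delta>" "\<bar>f r - g r\<bar> < \<delta>"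
      using \<delta>(1) by blast
    have "(\<lambda>x. f x - g x) \<in> finite_energy b"
      by (rule seminorm_diff(1)[OF fD finite_support_finite_energy[OF g(1)]])
    note le = C(2)[OF this]
    have "C * (seminorm (\<lambda>x. f x - g x) + \<bar>f r - g r\<bar>) < \<epsilon>"
      unfolding \<delta>(2)[symmetric] by (intro mult_strict_left_mono add_strict_mono g C(1))
    then have lt: "\<bar>f x - g x\<bar> < \<epsilon>" for x by (rule le_less_trans[OF le])
    have "{x. \<bar>f x\<bar> \<ge> \<epsilon>} \<subseteq> {x. g x \<noteq> 0}"
    proof
      fix x show "x \<in> {x. \<bar>f x\<bar> \<ge> \<epsilon>} \<Longrightarrow> x \<in> {x. g x \<noteq> 0}" using lt[of x] by auto
    qed
    then show ?thesis
      by (rule finite_subset) (use g(1) in \<open>simp add: finite_support_def\<close>)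
  qed
  then show "f \<in> vanishing_at_infinity" by (simp add: vanishing_at_infinity_iff)
qed

section \<open>Royden decomposition and limits at infinity\<close>

lemma uniformly_transient_imp_transient:
  assumes "uniformly_transient b r" "infinite (UNIV :: 'v set)"
  shows "transient b r"
proof -
  have "(\<lambda>_::'v. 1::real) \<notin> vanishing_at_infinity"
    using assms(2) by (auto simp: vanishing_at_infinity_iff intro!: exI[of _ 1])
  then show ?thesis
    using assms(1) by (auto simp: transient_def recurrent_iff uniformly_transient_def)
qed

text \<open>The first summand minimises \<open>seminorm (f - g)\<close> over the closure of the finitely supported
  functions; a minimising sequence is Cauchy by the parallelogram law and, as the graph is
  transient, converges pointwise.\<close>

lemma Royden_decomposition:
  assumes tr: "transient b r" and f: "f \<in> finite_energy b"
  obtains g h where "g \<in> finite_energy0 b r" "h \<in> finite_energy b" "harmonic b h" "\<And>x. f x = g x + h x"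
proof -
  define q where "q g = (seminorm (\<lambda>x. f x - g x))\<^sup>2" for g
  define m where "m = (INF g\<in>finite_support. q g)"
  have ne: "(\<lambda>_. 0) \<in> (finite_support :: ('v \<Rightarrow> real) set)" by (simp add: finite_support_def)
  have bdd: "bdd_below (q ` finite_support)" by (rule bdd_belowI[of _ 0]) (auto simp: q_def)
  have m_le: "m \<le> q g" if "g \<in> finite_support" for g
    unfolding m_def by (rule cINF_lower[OF bdd that])
  have m0: "m \<ge> 0" unfolding m_def by (rule cINF_greatest) (use ne in \<open>auto simp: q_def\<close>)
  have "\<exists>g\<in>finite_support. q g < m + 1 / real (Suc n)" for n
    using cINF_less_iff[OF _ bdd, of "m + 1 / real (Suc n)"] ne by (auto simp: m_def[symmetric])
  then obtain G where G: "\<And>n. G n \<in> finite_support" and Gq: "\<And>n. q (G n) < m + 1 / real (Suc n)"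
    by metis
  have GD: "G n \<in> finite_energy b" for n by (rule finite_support_finite_energy[OF G])
  have diffD: "(\<lambda>x. G n x - G k x) \<in> finite_energy b" for n k
    by (rule seminorm_diff(1)[OF GD GD])
  have fG: "(\<lambda>x. f x - G n x) \<in> finite_energy b" for n
    by (rule seminorm_diff(1)[OF f GD])
  have cauchy: "(seminorm (\<lambda>x. G n x - G k x))\<^sup>2 \<le> 2 / real (Suc n) + 2 / real (Suc k)" for n k
  proof -
    \<comment> \<open>The midpoint is again finitely supported, so \<open>q mid\<close> is at least
      \<open>m\<close>; in the parallelogram law this leaves only the excesses of
      \<open>q (G n)\<close> and \<open>q (G k)\<close> over \<open>m\<close>.\<close>
    define mid where "mid x = 1 / 2 * (G n x + G k x)" for x
    have mid: "mid \<in> finite_support"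
      unfolding mid_def by (intro finite_support_scale finite_support_add G)
    have "seminorm (\<lambda>x. f x - mid x) = seminorm (\<lambda>x. 1 / 2 * ((f x - G n x) + (f x - G k x)))"
      by (rule arg_cong[where f = seminorm]) (auto simp: mid_def algebra_simps)
    also have "\<dots> \<le> \<bar>1 / 2\<bar> * seminorm (\<lambda>x. (f x - G n x) + (f x - G k x))"
      by (intro seminorm_scale(2) seminorm_triangle(1) fG)
    finally have "q mid \<le> (\<bar>1 / 2\<bar> * seminorm (\<lambda>x. (f x - G n x) + (f x - G k x)))\<^sup>2"
      unfolding q_def by (intro power_mono) auto
    then have 1: "4 * m \<le> (seminorm (\<lambda>x. (f x - G n x) + (f x - G k x)))\<^sup>2"
      using m_le[OF mid] by (simp add: power_divide)
    have "seminorm (\<lambda>x. G n x - G k x) = seminorm (\<lambda>x. (f x - G k x) - (f x - G n x))"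
      by (rule arg_cong[where f = seminorm]) auto
    moreover have "(\<lambda>x. (f x - G n x) + (f x - G k x)) = (\<lambda>x. (f x - G k x) + (f x - G n x))"
      by (auto simp: add.commute)
    ultimately have "(seminorm (\<lambda>x. G n x - G k x))\<^sup>2
        = 2 * q (G k) + 2 * q (G n) - (seminorm (\<lambda>x. (f x - G n x) + (f x - G k x)))\<^sup>2"
      using seminorm_parallelogram[OF fG[of k] fG[of n]] by (simp add: q_def)
    then show ?thesis using 1 Gq[of n] Gq[of k] by simp
  qed
  have conv: "convergent (\<lambda>n. G n x)" for x
  proof -
    obtain C1 where C1: "C1 \<ge> 0" "\<And>f. f \<in> finite_energy b \<Longrightarrow> \<bar>f x - f r\<bar> \<le> C1 * seminorm f"
      using increment_le_seminorm by blast
    obtain C2 where C2: "C2 > 0" "\<And>g. g \<in> finite_support \<Longrightarrow> \<bar>g r\<bar> \<le> C2 * seminorm g"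
      using transient_imp_value_le_seminorm[OF tr] by blast
    \<comment> \<open>Transience controls the value at \<open>r\<close>, connectedness the increment
      from \<open>r\<close> to \<open>x\<close>.\<close>
    have le: "\<bar>G n x - G k x\<bar> \<le> (C1 + C2) * seminorm (\<lambda>x. G n x - G k x)" for n k
    proof -
      have "(\<lambda>x. G n x + (- 1) * G k x) \<in> finite_support"
        by (intro finite_support_add finite_support_scale G)
      from C2(2)[OF this] have "\<bar>G n r - G k r\<bar> \<le> C2 * seminorm (\<lambda>x. G n x - G k x)"
        by simp
      moreover have "\<bar>(G n x - G k x) - (G n r - G k r)\<bar> \<le> C1 * seminorm (\<lambda>x. G n x - G k x)"
        by (rule C1(2)[OF diffD])
      ultimately show ?thesis unfolding distrib_right by linarith
    qed
    have "Cauchy (\<lambda>n. G n x)"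
    proof (rule metric_CauchyI)
      fix e :: real assume e: "e > 0"
      define D where "D = C1 + C2"
      have D: "D > 0" using C1 C2 by (simp add: D_def)
      \<comment> \<open>This makes \<open>4 / real (Suc M)\<close>, the Cauchy bound beyond
        \<open>M\<close>, smaller than the square of \<open>e / D\<close>.\<close>
      obtain M :: nat where M: "real M > 4 * D\<^sup>2 / e\<^sup>2" using reals_Archimedean2 by blast
      have "dist (G n x) (G k x) < e" if "n \<ge> M" "k \<ge> M" for n k
      proof -
        have "2 / real (Suc n) + 2 / real (Suc k) \<le> 2 / real (Suc M) + 2 / real (Suc M)"
          using that by (intro add_mono divide_left_mono) auto
        then have "(seminorm (\<lambda>x. G n x - G k x))\<^sup>2 \<le> 4 / real (Suc M)"
          using cauchy[of n k] by simp
        also have "\<dots> < (e / D)\<^sup>2"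
        proof -
          have "4 * D\<^sup>2 < real M * e\<^sup>2"
            using M e by (simp add: pos_divide_less_eq)
          also have "\<dots> \<le> real (Suc M) * e\<^sup>2" by (intro mult_right_mono) auto
          finally show ?thesis
            using D by (simp add: power_divide pos_divide_less_eq pos_less_divide_eq mult.commute)
        qed
        finally have "seminorm (\<lambda>x. G n x - G k x) < e / D"
          by (rule power_less_imp_less_base) (use e D in auto)
        then have "D * seminorm (\<lambda>x. G n x - G k x) < e"
          using D by (simp add: pos_less_divide_eq mult.commute)
        then show ?thesis using le[of n k] unfolding dist_real_def D_def by linarith
      qed
      then show "\<exists>M. \<forall>n\<ge>M. \<forall>k\<ge>M. dist (G n x) (G k x) < e" by blast
    qed
    then show ?thesis by (rule Cauchy_convergent)
  qed
  define g where "g x = lim (\<lambda>n. G n x)" for x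
  have lim: "(\<lambda>n. G n x) \<longlonglongrightarrow> g x" for x
    unfolding g_def using conv by (simp add: convergent_LIMSEQ_iff)
  \<comment> \<open>Let \<open>k\<close> tend to infinity in the Cauchy bound: for \<open>k\<close>
    at least \<open>n\<close> both of its terms are at most \<open>2 / real (Suc n)\<close>.\<close>
  have gG: "(\<lambda>x. g x - G n x) \<in> finite_energy b"
      "seminorm (\<lambda>x. g x - G n x) \<le> sqrt (4 / real (Suc n))" for n
  proof -
    have *: "\<forall>\<^sub>F k in sequentially. seminorm (\<lambda>x. G k x - G n x) \<le> sqrt (4 / real (Suc n))"
      using eventually_ge_at_top[of n]
    proof eventually_elim
      case (elim k)
      have "2 / real (Suc k) \<le> 2 / real (Suc n)" using elim by (intro divide_left_mono) auto
      then show ?case using cauchy[of k n] by (intro real_le_rsqrt) simp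
    qed
    have "(\<lambda>k. G k x - G n x) \<longlonglongrightarrow> g x - G n x" for x by (intro tendsto_intros lim)
    from seminorm_lower_semicontinuous[OF diffD this *]
    show "(\<lambda>x. g x - G n x) \<in> finite_energy b"
      "seminorm (\<lambda>x. g x - G n x) \<le> sqrt (4 / real (Suc n))" by auto
  qed
  have lim0: "(\<lambda>n. sqrt (4 / real (Suc n))) \<longlonglongrightarrow> 0"
    using tendsto_real_sqrt[OF LIMSEQ_Suc[OF lim_const_over_n[of 4]]] by simp
  have gD: "g \<in> finite_energy b"
    using seminorm_triangle(1)[OF gG(1)[of 0] GD[of 0]] by simp
  have g0: "g \<in> finite_energy0 b r"
    unfolding finite_energy0_iff
  proof (intro conjI allI impI gD)
    fix \<epsilon> :: real assume \<epsilon>: "\<epsilon> > 0"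
    have "\<forall>\<^sub>F n in sequentially. sqrt (4 / real (Suc n)) < \<epsilon>"
      by (rule order_tendstoD(2)[OF lim0 \<epsilon>])
    moreover have "\<forall>\<^sub>F n in sequentially. dist (G n r) (g r) < \<epsilon>"
      by (rule tendstoD[OF lim \<epsilon>])
    ultimately have "\<forall>\<^sub>F n in sequentially. seminorm (\<lambda>x. g x - G n x) < \<epsilon> \<and> \<bar>g r - G n r\<bar> < \<epsilon>"
    proof eventually_elim
      case (elim n)
      have "seminorm (\<lambda>x. g x - G n x) < \<epsilon>"
        by (rule le_less_trans[OF gG(2) elim(1)])
      moreover have "\<bar>g r - G n r\<bar> < \<epsilon>"
        using elim(2) by (simp only: dist_real_def abs_minus_commute)
      ultimately show ?case ..
    qed
    then obtain n where "seminorm (\<lambda>x. g x - G n x) < \<epsilon> \<and> \<bar>g r - G n r\<bar> < \<epsilon>"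
      using eventually_happens'[OF sequentially_bot] by blast
    then show "\<exists>g'\<in>finite_support. seminorm (\<lambda>x. g x - g' x) < \<epsilon> \<and> \<bar>g r - g' r\<bar> < \<epsilon>"
      by (intro bexI[of _ "G n"] G)
  qed
  define h where "h x = f x - g x" for x
  have hD: "h \<in> finite_energy b" unfolding h_def by (rule seminorm_diff(1)[OF f gD])
  \<comment> \<open>Lower semicontinuity shows that the infimum is attained in the limit.\<close>
  have "seminorm h \<le> sqrt m + \<epsilon>" if "\<epsilon> > 0" for \<epsilon>
    unfolding h_def
  proof (rule seminorm_lower_semicontinuous(2)[OF fG])
    show "(\<lambda>n. f x - G n x) \<longlonglongrightarrow> f x - g x" for x by (intro tendsto_intros lim)
    have "(\<lambda>n. sqrt (m + 1 / real (Suc n))) \<longlonglongrightarrow> sqrt (m + 0)"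
      using LIMSEQ_Suc[OF lim_const_over_n[of 1]] by (intro tendsto_intros) auto
    then have "\<forall>\<^sub>F n in sequentially. sqrt (m + 1 / real (Suc n)) < sqrt m + \<epsilon>"
      by (rule order_tendstoD(2)) (use that in simp)
    then show "\<forall>\<^sub>F n in sequentially. seminorm (\<lambda>x. f x - G n x) \<le> sqrt m + \<epsilon>"
    proof eventually_elim
      case (elim n)
      have "seminorm (\<lambda>x. f x - G n x) \<le> sqrt (m + 1 / real (Suc n))"
        using Gq[of n] by (intro real_le_rsqrt) (simp add: q_def)
      then show ?case using elim by simp
    qed
  qed
  then have hm: "seminorm h \<le> sqrt m" by (rule field_le_epsilon)
  have "harmonic b h"
  proof (rule harmonic_if_minimal[OF hD])
    fix u :: 'v and t :: real
    define e where "e x = t * (if x = u then 1 else (0::real))" for x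
    have e: "e \<in> finite_support"
      unfolding e_def by (rule finite_support_scale) (simp add: finite_support_def)
    have he: "(\<lambda>x. h x + e x) \<in> finite_energy b"
      by (rule seminorm_triangle(1)[OF hD finite_support_finite_energy[OF e]])
    \<comment> \<open>Up to the error \<open>g - G n\<close>, the function \<open>h + e\<close> is
      \<open>f\<close> minus the finitely supported \<open>G n - e\<close>, whose distance from
      \<open>f\<close> is at least \<open>sqrt m\<close>.\<close>
    have "sqrt m \<le> seminorm (\<lambda>x. h x + e x) + sqrt (4 / real (Suc n))" for n
    proof -
      have "(\<lambda>x. G n x + (- 1) * e x) \<in> finite_support"
        by (intro finite_support_add finite_support_scale G e)
      then have "sqrt m \<le> sqrt (q (\<lambda>x. G n x + (- 1) * e x))"
        by (intro real_sqrt_le_mono m_le)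
      also have "\<dots> = seminorm (\<lambda>x. f x - (G n x + (- 1) * e x))" by (simp add: q_def)
      also have "\<dots> = seminorm (\<lambda>x. (h x + e x) + (g x - G n x))"
        by (rule arg_cong[where f = seminorm]) (auto simp: h_def)
      also have "\<dots> \<le> seminorm (\<lambda>x. h x + e x) + seminorm (\<lambda>x. g x - G n x)"
        by (rule seminorm_triangle(2)[OF he gG(1)])
      finally show ?thesis using gG(2)[of n] by linarith
    qed
    then have "sqrt m \<le> seminorm (\<lambda>x. h x + e x) + 0"
      by (intro LIMSEQ_le_const[OF tendsto_add[OF tendsto_const lim0]]) auto
    then show "seminorm h \<le> seminorm (\<lambda>x. h x + t * (if x = u then 1 else 0))"
      using hm by (simp add: e_def)
  qed
  then show thesis
    using that[OF g0 hD] by (simp add: h_def)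
qed

text \<open>In the Royden decomposition the harmonic part is constant and the other part vanishes at
  infinity, so the constant is the limit.\<close>

lemma uniformly_transient_imp_limit:
  assumes "uniformly_transient b r" "infinite (UNIV :: 'v set)"
    and const: "\<And>f. harmonic b f \<Longrightarrow> f \<in> finite_energy b \<Longrightarrow> \<exists>a. \<forall>x. f x = a"
    and f: "f \<in> finite_energy b"
  shows "\<exists>c. (\<lambda>x. f x - c) \<in> vanishing_at_infinity"
proof -
  obtain g h where gh: "g \<in> finite_energy0 b r" "h \<in> finite_energy b" "harmonic b h" "\<And>x. f x = g x + h x"
    by (rule Royden_decomposition[OF uniformly_transient_imp_transient[OF assms(1,2)] f]) (rule that)
  obtain a where a: "\<And>x. h x = a" using const[OF gh(3,2)] by blast
  have "g \<in> vanishing_at_infinity" using gh(1) assms(1) by (auto simp: uniformly_transient_def)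
  then have "(\<lambda>x. f x - a) \<in> vanishing_at_infinity" by (simp add: gh(4) a)
  then show ?thesis ..
qed

section \<open>The maximum principle\<close>

lemma harmonic_le_limit:
  assumes "harmonic b f" "f \<in> finite_energy b" "infinite (UNIV :: 'v set)"
    and lim: "(\<lambda>x. f x - c) \<in> vanishing_at_infinity"
  shows "f z \<le> c"
proof (rule ccontr)
  assume z: "\<not> f z \<le> c"
  \<comment> \<open>Above the limit \<open>c\<close> the superlevel set is finite, so
    \<open>f\<close> attains its maximum.\<close>
  define K where "K = {x. f x \<ge> f z}"
  have "{x. \<bar>f x - c\<bar> \<ge> f z - c} \<supseteq> K" using z by (auto simp: K_def)
  moreover have "finite {x. \<bar>f x - c\<bar> \<ge> f z - c}" using z lim by (simp add: vanishing_at_infinity_iff)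
  ultimately have "finite K" by (rule finite_subset)
  moreover have "z \<in> K" by (simp add: K_def)
  ultimately have K: "finite K" "z \<in> K" .
  define M where "M = Max (f ` K)"
  obtain x0 where x0: "x0 \<in> K" "f x0 = M"
  proof -
    have "M \<in> f ` K" unfolding M_def by (rule Max_in) (use K in auto)
    then show ?thesis using that by auto
  qed
  have le: "f x \<le> M" for x
  proof (cases "x \<in> K")
    case True
    then show ?thesis using K by (simp add: M_def)
  next
    case False
    then have "f x \<le> f z" by (simp add: K_def)
    also have "\<dots> \<le> M" using K by (simp add: M_def)
    finally show ?thesis .
  qed
  \<comment> \<open>At a maximum the Laplacian is a sum of nonnegative terms; as it is 0, each term
    vanishes and the maximum spreads to all neighbours.\<close>
  have step: "f y = M" if "f x = M" "b x y > 0" for x y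
  proof -
    have "b x y * (f x - f y) = 0"
    proof (rule nonneg_infsum_le_0D[of "\<lambda>y. b x y * (f x - f y)" UNIV])
      show "(\<Sum>\<^sub>\<infinity>y. b x y * (f x - f y)) \<le> 0" using assms(1) by (simp add: harmonic_def)
      show "b x y * (f x - f y) \<ge> 0" for y
        unfolding that(1) by (rule mult_nonneg_nonneg[OF b_nonneg]) (simp add: le)
    qed (simp_all add: laplacian_summable(2)[OF assms(2)])
    then show ?thesis using that by auto
  qed
  have "f x = M" for x
  proof (cases "x = x0")
    case False
    then obtain n :: nat and p where p: "p 0 = x0" "p n = x" "\<And>i. i \<in> {1..n} \<Longrightarrow> b (p (i - 1)) (p i) > 0"
      using connected unfolding connected_graph_def by metis
    have "f (p k) = M" if "k \<le> n" for k
      using that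
    proof (induction k)
      case 0
      then show ?case using x0 p by simp
    next
      case (Suc k)
      then show ?case by (intro step[OF Suc.IH]) (use p(3)[of "Suc k"] in auto)
    qed
    then show ?thesis using p(2) by blast
  qed (use x0 in simp)
  then have "K = UNIV" by (auto simp: K_def)
  then show False using K(1) assms(3) by simp
qed

lemma harmonic_eq_limit:
  assumes "harmonic b f" "f \<in> finite_energy b" "infinite (UNIV :: 'v set)"
    and lim: "(\<lambda>x. f x - c) \<in> vanishing_at_infinity"
  shows "f z = c"
proof (rule antisym)
  show "f z \<le> c" by (rule harmonic_le_limit[OF assms])
  \<comment> \<open>The reverse inequality is the maximum principle for \<open>-f\<close>.\<close>
  have "- f z \<le> - c"
  proof (rule harmonic_le_limit[of "\<lambda>x. - f x"])
    have "(\<Sum>\<^sub>\<infinity>y. b x y * (- f x - - f y)) = - (\<Sum>\<^sub>\<infinity>y. b x y * (f x - f y))" for x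
      unfolding infsum_uminus[symmetric] by (rule infsum_cong) (simp add: algebra_simps)
    then show "harmonic b (\<lambda>x. - f x)" using assms(1) by (simp add: harmonic_def)
    show "(\<lambda>x. - f x) \<in> finite_energy b"
      using seminorm_scale(1)[OF assms(2), of "-1"] by simp
    have "\<bar>- f x - - c\<bar> = \<bar>f x - c\<bar>" for x by linarith
    then show "(\<lambda>x. - f x - - c) \<in> vanishing_at_infinity"
      using lim unfolding vanishing_at_infinity_iff by simp
  qed (rule assms)
  then show "c \<le> f z" by simp
qed

section \<open>Boundedness from limits at infinity\<close>

lemma limits_imp_canonically_compactifiable:
  assumes tr: "transient b r"
    and lim: "\<And>f. f \<in> finite_energy b \<inter> bounded_functions \<Longrightarrow> \<exists>c. (\<lambda>x. f x - c) \<in> vanishing_at_infinity"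
  shows "canonically_compactifiable b"
  unfolding canonically_compactifiable_def
proof (rule subsetI, rule ccontr)
  fix f assume f: "f \<in> finite_energy b" and unb: "f \<notin> bounded_functions"
  define T where "T n x = min \<bar>f x\<bar> (real n)" for n x
  have T: "T n \<in> finite_energy b" "seminorm (T n) \<le> seminorm f" for n
  proof -
    have "\<bar>T n x - T n y\<bar> \<le> 1 * \<bar>f x - f y\<bar>" for x y
      unfolding T_def min_def by (simp split: if_split) linarith
    from seminorm_contraction[OF f this] show "T n \<in> finite_energy b" "seminorm (T n) \<le> seminorm f"
      by auto
  qed
  have small: "finite {x. \<bar>f x\<bar> < real n}" for n
  proof -
    have "T (Suc n) \<in> bounded_functions"
      by (auto simp: bounded_functions_def bounded_iff T_def intro!: exI[of _ "real (Suc n)"])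
    then obtain c where "(\<lambda>x. T (Suc n) x - c) \<in> vanishing_at_infinity"
      using lim T(1) by blast
    then have fin: "finite {x. \<bar>T (Suc n) x - c\<bar> \<ge> \<epsilon>}" if "\<epsilon> > 0" for \<epsilon>
      using that by (simp add: vanishing_at_infinity_iff)
    \<comment> \<open>A smaller limit would keep the truncation below its cap outside a finite set,
      and \<open>f\<close> would be bounded.\<close>
    have "c \<ge> real (Suc n)"
    proof (rule ccontr)
      assume c: "\<not> c \<ge> real (Suc n)"
      define B where "B = {x. \<bar>T (Suc n) x - c\<bar> \<ge> real (Suc n) - c}"
      have B: "finite B" unfolding B_def by (rule fin) (use c in simp)
      have "\<bar>f x\<bar> \<le> real (Suc n)" if "x \<notin> B" for x
      proof (rule ccontr)
        assume "\<not> \<bar>f x\<bar> \<le> real (Suc n)"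
        then have "T (Suc n) x = real (Suc n)" by (simp add: T_def)
        then show False using that c by (simp add: B_def)
      qed
      then have "range f \<subseteq> f ` B \<union> {- real (Suc n)..real (Suc n)}"
        by (fastforce simp: abs_le_iff)
      then have "bounded (range f)"
        using B by (meson bounded_Un bounded_closed_interval bounded_subset finite_imageI finite_imp_bounded)
      then show False using unb by (simp add: bounded_functions_def)
    qed
    \<comment> \<open>Truncating at \<open>Suc n\<close> rather than \<open>n\<close> leaves a gap
      of 1 between these values and the limit.\<close>
    then have "{x. \<bar>f x\<bar> < real n} \<subseteq> {x. \<bar>T (Suc n) x - c\<bar> \<ge> 1}"
      by (auto simp: T_def)
    then show ?thesis by (rule finite_subset) (simp add: fin)
  qed
  have "\<exists>g\<in>finite_support. seminorm (\<lambda>x. 1 - g x) < \<epsilon> \<and> \<bar>1 - g r\<bar> < \<epsilon>" if \<epsilon>: "\<epsilon> > 0" for \<epsilon> :: real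
  proof -
    \<comment> \<open>Both the seminorm of \<open>f\<close> and its value at \<open>r\<close> are
      divided by \<open>n\<close> below.\<close>
    obtain n :: nat where n: "real n > max (seminorm f) \<bar>f r\<bar> / \<epsilon>" using reals_Archimedean2 by blast
    have "0 \<le> max (seminorm f) \<bar>f r\<bar> / \<epsilon>" using \<epsilon> by (auto simp: le_max_iff_disj)
    then have n0: "real n > 0" using n by linarith
    have n': "max (seminorm f) \<bar>f r\<bar> < \<epsilon> * real n" using n \<epsilon> by (simp add: pos_divide_less_eq mult.commute)
    \<comment> \<open>This vanishes wherever \<open>|f|\<close> is at least \<open>n\<close>, hence
      outside a finite set.\<close>
    define g where "g x = 1 - 1 / real n * T n x" for x
    have "{x. g x \<noteq> 0} \<subseteq> {x. \<bar>f x\<bar> < real n}"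
      using n0 by (auto simp: g_def T_def min_def split: if_splits)
    then have "g \<in> finite_support"
      unfolding finite_support_def mem_Collect_eq using small by (rule finite_subset)
    moreover have "seminorm (\<lambda>x. 1 - g x) < \<epsilon>"
    proof -
      have "seminorm (\<lambda>x. 1 - g x) \<le> \<bar>1 / real n\<bar> * seminorm (T n)"
        unfolding g_def using seminorm_scale(2)[OF T(1), of "1 / real n" n] by simp
      also have "\<dots> \<le> seminorm f / real n" using T(2)[of n] n0 by (simp add: divide_right_mono)
      also have "\<dots> < \<epsilon>" using n' n0 by (simp add: pos_divide_less_eq)
      finally show ?thesis .
    qed
    moreover have "\<bar>1 - g r\<bar> < \<epsilon>"
    proof -
      have "\<bar>1 - g r\<bar> = T n r / real n" by (simp add: g_def T_def)
      also have "\<dots> \<le> \<bar>f r\<bar> / real n" using n0 by (intro divide_right_mono) (auto simp: T_def)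
      also have "\<dots> < \<epsilon>" using n' n0 by (simp add: pos_divide_less_eq)
      finally show ?thesis .
    qed
    ultimately show ?thesis by blast
  qed
  then have "recurrent b r" by (simp add: recurrent_iff finite_energy0_iff finite_energy_const)
  then show False using tr by (simp add: transient_def)
qed

end

section \<open>The cycle of implications between the three conditions\<close>

theorem theorem6p2:
  fixes b :: "'v \<Rightarrow> 'v \<Rightarrow> real" and r :: 'v
  assumes "countable (UNIV :: 'v set)" and "infinite (UNIV :: 'v set)"
    and "weighted_graph b" and "connected_graph b"
  shows
    "(uniformly_transient b r \<and>
        (\<forall>f. harmonic b f \<and> f \<in> finite_energy b \<longrightarrow> (\<exists>a. \<forall>x. f x = a))
      \<longleftrightarrow>
      canonically_compactifiable b \<and>
        (\<forall>f. harmonic b f \<and> f \<in> finite_energy b \<longrightarrow> (\<exists>a. \<forall>x. f x = a)))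
     \<and>
     (canonically_compactifiable b \<and>
        (\<forall>f. harmonic b f \<and> f \<in> finite_energy b \<longrightarrow> (\<exists>a. \<forall>x. f x = a))
      \<longleftrightarrow>
      transient b r \<and>
        (case Royden_compactification b of (R, i) \<Rightarrow> is_one_point_compactification R i))"
    (is "(?ut \<and> ?const \<longleftrightarrow> ?cc \<and> ?const) \<and> (?cc \<and> ?const \<longleftrightarrow> ?tr \<and> ?one)")
proof -
  interpret connected_energy_graph b
    using assms by (simp add: connected_energy_graph_def connected_energy_graph_axioms_def energy_graph_def)
  obtain R i where Ri: "Royden_compactification b = (R, i)" by (cases "Royden_compactification b")
  have R: "is_Royden_compactification b R i"
    by (rule is_Royden_compactification_Royden[OF assms(3) Ri])
  have one: "?one \<longleftrightarrow> is_one_point_compactification R i" by (simp add: Ri)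
  have lim: "\<exists>c. (\<lambda>x. f x - c) \<in> vanishing_at_infinity" if ?ut ?const "f \<in> finite_energy b" for f
    by (rule uniformly_transient_imp_limit[OF that(1) assms(2) _ that(3)]) (use that(2) in blast)
  have tr: ?tr if ?ut
    by (rule uniformly_transient_imp_transient[OF that assms(2)])
  have ut: ?ut if ?cc
    by (rule canonically_compactifiable_imp_uniformly_transient[OF that])
  have cc: ?cc if ?ut ?const
    by (rule limits_imp_canonically_compactifiable[OF tr[OF that(1)]]) (use lim[OF that] in blast)
  have 1: ?one if ?ut ?const
  proof -
    \<comment> \<open>This space has another point type than \<open>R\<close>; uniqueness across
      types supplies a homeomorphism fixing the vertices.\<close>
    have "is_Royden_compactification b (one_point_space :: 'v option topology) Some"
      by (rule Royden_compactification_one_point[OF assms(3,2)]) (use lim[OF that] in blast)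
    from Royden_compactification_unique[OF R this] have "is_one_point_compactification R i"
      by (simp add: is_one_point_compactification_def)
    then show ?thesis by (rule iffD2[OF one])
  qed
  have 2: "?cc \<and> ?const" if ?tr ?one
  proof -
    have lims: "\<exists>c. (\<lambda>x. f x - c) \<in> vanishing_at_infinity" if "f \<in> finite_energy b \<inter> bounded_functions" for f
      using one_point_compactification_imp_limit[OF R _ that] \<open>?one\<close> by (simp add: one)
    have cc: ?cc by (rule limits_imp_canonically_compactifiable[OF \<open>?tr\<close> lims])
    have "\<exists>a. \<forall>x. f x = a" if f: "harmonic b f" "f \<in> finite_energy b" for f
    proof -
      obtain c where "(\<lambda>x. f x - c) \<in> vanishing_at_infinity"
        \<comment> \<open>The limits are known for bounded functions only; canonical
          compactifiability, just obtained, makes \<open>f\<close> bounded.\<close>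
        using lims[of f] cc f(2) by (auto simp: canonically_compactifiable_def)
      from harmonic_eq_limit[OF f assms(2) this] show ?thesis by blast
    qed
    then show ?thesis using cc by blast
  qed
  \<comment> \<open>The first condition yields the third by \<open>tr\<close> and \<open>1\<close>,
    the third the second by \<open>2\<close>, and the second the first by \<open>ut\<close>;
    \<open>cc\<close> leads directly from the first to the second.\<close>
  show ?thesis using tr ut cc 1 2 by argo
qed

end
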